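(* Suppose that $\alpha\in(0,\infty)\setminus\mathbb{N}$ and $k\in\mathbb{N}_0$ with $k\le 2\alpha+1$. Then there exists a constant $A_{\alpha,k}>0$, depending only on $\alpha$ and $k$, such that for every $c\ge 1$, $$\big\|\widehat{L}_{\alpha,c}^{(k)}\big\|_{L_1(\mathbb{R})}\le A_{\alpha,k}\,c^{(2k+1)(2\alpha-\lfloor\alpha\rfloor)+k}.$$
   Context: $\mathbb{N}_0=\{0,1,2,\dots\}$. For $c>0$ and $\alpha\in\mathbb{R}\setminus\mathbb{N}_0$, the one-dimensional general multiquadric $\phi_{\alpha,c}(x)=(x^2+c^2)^\alpha$ has generalized Fourier transform $$\widehat{\phi}_{\alpha,c}(\xi)=\frac{2^{1+\alpha}}{\Gamma(-\alpha)}\Big(\frac{c}{|\xi|}\Big)^{\alpha+\frac12}K_{\alpha+\frac12}(c|\xi|),\quad \xi\neq 0,$$ where $K_\nu$ is the modified Bessel function of the second kind. Set $$\widehat{L}_{\alpha,c}(\xi)=\frac{\widehat{\phi}_{\alpha,c}(\xi)}{\sum_{j\in\mathbb{Z}}\widehat{\phi}_{\alpha,c}(\xi+2\pi j)},\quad\xi\in\mathbb{R}$$ (extended by continuity to $\xi\in2\pi\mathbb{Z}$). $\widehat{L}_{\alpha,c}^{(k)}$ denotes the $k$-th derivative. *)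

theory Defs
  imports "HOL-Analysis.Analysis"
begin

text \<open>Modified Bessel function of the second kind of real order \<open>\<nu>\<close>, given for \<open>x > 0\<close> by
  its standard integral representation; the integral diverges for \<open>x \<le> 0\<close>.\<close>
definition bessel_K :: "real \<Rightarrow> real \<Rightarrow> real" where
  "bessel_K \<nu> x = (LBINT t:{0..}. exp (- x * cosh t) * cosh (\<nu> * t))"

text \<open>Generalized Fourier transform of the multiquadric \<open>x \<mapsto> (x\<^sup>2 + c\<^sup>2) powr \<alpha>\<close>, away from the
  origin. The value at \<open>\<xi> = 0\<close> is an artefact of division by zero.\<close>
definition multiquadric_hat :: "real \<Rightarrow> real \<Rightarrow> real \<Rightarrow> real" where
  "multiquadric_hat \<alpha> c \<xi> =
     2 powr (1 + \<alpha>) / Gamma (- \<alpha>) * (c / \<bar>\<xi>\<bar>) powr (\<alpha> + 1/2)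
       * bessel_K (\<alpha> + 1/2) (c * \<bar>\<xi>\<bar>)"

definition cardinal_quotient :: "real \<Rightarrow> real \<Rightarrow> real \<Rightarrow> real" where
  "cardinal_quotient \<alpha> c \<xi> =
     multiquadric_hat \<alpha> c \<xi> /
     (\<Sum>\<^sub>\<infinity>j\<in>(UNIV :: int set). multiquadric_hat \<alpha> c (\<xi> + 2 * pi * of_int j))"

text \<open>The quotient is meaningful only off \<open>2 \<pi> \<int>\<close>, as one term of the periodization is singular
  there; at those points the function is its limit, i.e. the extension by continuity.\<close>
definition cardinal_hat :: "real \<Rightarrow> real \<Rightarrow> real \<Rightarrow> real" where
  "cardinal_hat \<alpha> c \<xi> =
     (if \<exists>m::int. \<xi> = 2 * pi * of_int m
      then Lim (at \<xi>) (cardinal_quotient \<alpha> c)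
      else cardinal_quotient \<alpha> c \<xi>)"

end

theory Submission imports Defs
begin

text \<open>Put \<open>\<nu> = \<alpha> + 1/2\<close>. Up to a constant that cancels in the quotient, the transform is
  \<open>G(x) = \<bar>x\<bar>\<^bsup>-2\<nu>\<^esup> h(c \<bar>x\<bar>)\<close> with \<open>h(y) = y\<^sup>\<nu> K\<^sub>\<nu>(y)\<close> decreasing. The Bessel recurrences give
  \<open>C (c + 1/\<bar>x\<bar>)\<^sup>i G\<close> as a bound for the \<open>i\<close>-th derivative of \<open>G\<close>, uniformly in \<open>c\<close>; bounds of this shape pass to periodizations and
  quotients, so near \<open>2 \<pi> m\<close> the \<open>i\<close>-th derivative of the cardinal function is
  \<open>O((c/\<bar>x\<bar>)\<^sup>i)\<close> times its deviation from its value there, \<open>x\<close> being the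
  distance to \<open>2 \<pi> m\<close>. By monotonicity of \<open>h\<close> that deviation is \<open>O(\<bar>x\<bar>\<^bsup>2\<nu>\<^esup> (1 + \<bar>m\<bar>)\<^bsup>-2\<nu>\<^esup>)\<close>, and since \<open>k \<le> 2\<nu>\<close> the \<open>k\<close>-th derivative is
  \<open>O(c\<^sup>k (1 + \<bar>m\<bar>)\<^bsup>-2\<nu>\<^esup>)\<close>, which is integrable and better than required. At the lattice points
  themselves only \<open>k = 2\<nu>\<close> is delicate; then \<open>k\<close> is even because \<open>\<alpha>\<close> is not an integer, and the
  deviation is \<open>x\<^sup>k\<close> times a function whose singularity is mild enough.\<close>

subsection \<open>The modified Bessel function\<close>

text \<open>The two halves of the claim ask for different things. The L1 bound needs constants
  uniform in c and in the lattice point m, but only off the lattice, which is a null set. Existence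
  of the derivatives at the lattice points concerns a fixed c and needs no rate. Hence there are two
  calculi, a quantitative one on punctured intervals (\<open>deriv_bound\<close>) and a qualitative
  one at 0 (\<open>euler_lim\<close>), each closed under sums, products and reciprocals. The
  quantitative one works because a positive function can serve as its own majorant: the derivative
  of G is at most a constant times (c + 1/|x|) G. The exponential decay of the Bessel function in c
  |x| is therefore never estimated; it cancels between numerator and denominator. In the same way
  the deviation is a majorant for itself, so its order of vanishing passes to all its derivatives.
  This is why for m = 0 the quotient minus 1, that is minus the tail over the periodization, is
  studied in place of the quotient.\<close>

definition bessel_kernel :: "real \<Rightarrow> real \<Rightarrow> real \<Rightarrow> real" where
  "bessel_kernel \<nu> x t = exp (- x * cosh t) * cosh (\<nu> * t)"

lemma bessel_kernel_nonneg: "0 \<le> bessel_kernel \<nu> x t"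
  by (simp add: bessel_kernel_def)

lemma bessel_K_eq: "bessel_K \<nu> x = (LBINT t:{0..}. bessel_kernel \<nu> x t)"
  by (simp add: bessel_K_def bessel_kernel_def)

lemma cosh_mult_cosh: "cosh a * cosh b = (cosh (a + b) + cosh (a - b)) / 2" for a b :: real
  by (simp add: cosh_add cosh_diff)

lemma sinh_mult_sinh: "sinh a * sinh b = (cosh (a + b) - cosh (a - b)) / 2" for a b :: real
  by (simp add: cosh_add cosh_diff)

lemma cosh_mult_bessel_kernel:
  "cosh t * bessel_kernel \<nu> x t = (bessel_kernel (\<nu> + 1) x t + bessel_kernel (\<nu> - 1) x t) / 2"
proof -
  have "cosh t * cosh (\<nu> * t) = (cosh ((\<nu> + 1) * t) + cosh ((\<nu> - 1) * t)) / 2"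
    using cosh_mult_cosh[of "\<nu> * t" t] by (simp add: algebra_simps)
  then have "exp (- x * cosh t) * (cosh t * cosh (\<nu> * t))
      = exp (- x * cosh t) * ((cosh ((\<nu> + 1) * t) + cosh ((\<nu> - 1) * t)) / 2)"
    by simp
  then show ?thesis
    by (simp only: bessel_kernel_def distrib_left times_divide_eq_right mult.left_commute)
qed

section \<open>Convergence, positivity and monotonicity in the order of the Bessel integral\<close>

lemma cosh_ge_quarter_square:
  fixes t :: real
  assumes "t \<ge> 0" shows "t\<^sup>2 / 4 \<le> cosh t"
proof -
  have "t\<^sup>2 / 2 \<le> exp t"
    using exp_lower_Taylor_quadratic[OF assms] assms by linarith
  then show ?thesis
    by (simp add: cosh_def)
       (smt (verit) exp_gt_zero field_sum_of_halves)
qed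

lemma cosh_le_exp_abs: "cosh t \<le> exp \<bar>t\<bar>" for t :: real
  by (cases "t \<ge> 0") (auto simp: cosh_def)

text \<open>By cosh t \<ge> t^2/4 the exponent lies below a concave parabola in t, and completing
  the square bounds it. Taking |\<nu>| + 1 in place of |\<nu>| leaves the factor exp (- t) over. The
  bound yields integrability here and the vanishing boundary term in the recurrence.\<close>

lemma bessel_kernel_le:
  assumes "x > 0" "t \<ge> 0"
  shows "bessel_kernel \<nu> x t \<le> exp ((\<bar>\<nu>\<bar> + 1)\<^sup>2 / x) * exp (- t)"
proof -
  define b where "b = \<bar>\<nu>\<bar> + 1"
  have sq: "0 \<le> (x * t / 2 - b)\<^sup>2" by simp
  have "b * t - x * (t\<^sup>2 / 4) \<le> b\<^sup>2 / x"
    using sq assms(1) by (simp add: field_simps power2_eq_square)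
  moreover have "x * (t\<^sup>2 / 4) \<le> x * cosh t"
    using assms cosh_ge_quarter_square by (intro mult_left_mono) auto
  ultimately have "b * t - x * cosh t \<le> b\<^sup>2 / x"
    by linarith
  then have "- x * cosh t + \<bar>\<nu> * t\<bar> \<le> b\<^sup>2 / x - t"
    using assms unfolding b_def abs_mult distrib_right by (simp add: mult.commute)
  moreover have "bessel_kernel \<nu> x t \<le> exp (- x * cosh t) * exp \<bar>\<nu> * t\<bar>"
    unfolding bessel_kernel_def by (intro mult_left_mono cosh_le_exp_abs) auto
  ultimately show ?thesis
    unfolding b_def exp_add[symmetric] by (smt (verit) exp_le_cancel_iff)
qed

lemma set_integrable_exp_minus: "set_integrable lborel {0::real..} (\<lambda>t. exp (- t))"
proof -
  have "(\<integral>\<^sup>+t. ennreal (exp (- t)) * indicator {0 ..} t \<partial>lborel) = ennreal (0 - (- exp (- 0)))"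
  proof (rule nn_integral_FTC_atLeast)
    show "((\<lambda>t::real. - exp (- t)) \<longlongrightarrow> 0) at_top"
      using tendsto_minus[OF filterlim_compose[OF exp_at_bot filterlim_uminus_at_bot_at_top]]
      by simp
  qed (auto intro!: derivative_eq_intros)
  then have "integrable lborel (\<lambda>t::real. exp (- t) * indicator {0..} t)"
    by (intro integrableI_nonneg) (auto simp: ennreal_mult' ennreal_indicator)
  then show ?thesis
    by (simp add: set_integrable_def mult.commute)
qed

lemma set_integrable_bessel_kernel:
  assumes "x > 0"
  shows "set_integrable lborel {0..} (bessel_kernel \<nu> x)"
proof (rule set_integrable_bound)
  show "set_integrable lborel {0..} (\<lambda>t. exp ((\<bar>\<nu>\<bar> + 1)\<^sup>2 / x) * exp (- t))"
    by (intro set_integrable_mult_right) (simp add: set_integrable_exp_minus)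
  have "continuous_on UNIV (bessel_kernel \<nu> x)"
    unfolding bessel_kernel_def by (intro continuous_intros)
  then have "bessel_kernel \<nu> x \<in> borel_measurable borel"
    by (rule borel_measurable_continuous_onI)
  then show "set_borel_measurable lborel {0..} (bessel_kernel \<nu> x)"
    unfolding set_borel_measurable_def by measurable
  show "AE t in lborel. t \<in> {0..} \<longrightarrow> norm (bessel_kernel \<nu> x t)
          \<le> norm (exp ((\<bar>\<nu>\<bar> + 1)\<^sup>2 / x) * exp (- t))"
    using bessel_kernel_le[OF assms, of _ \<nu>] bessel_kernel_nonneg by auto
qed

lemma bessel_K_pos:
  assumes "x > 0" shows "bessel_K \<nu> x > 0"
proof -
  have c: "set_integrable lborel {0..1::real} (\<lambda>t. exp (- x * cosh 1))"
    by (intro borel_integrable_atLeastAtMost' continuous_intros)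
  have "exp (- x * cosh 1) = (LBINT t:{0..1::real}. exp (- x * cosh 1))"
    by (simp add: set_lebesgue_integral_def)
  also have "\<dots> \<le> (LBINT t:{0..1}. bessel_kernel \<nu> x t)"
  proof (rule set_integral_mono[OF c])
    show "set_integrable lborel {0..1} (bessel_kernel \<nu> x)"
      by (rule set_integrable_subset[OF set_integrable_bessel_kernel[OF assms]]) auto
    fix t :: real assume "t \<in> {0..1}"
    then have "exp (- x * cosh 1) \<le> exp (- x * cosh t)"
      using assms by (simp add: cosh_real_nonneg_le_iff)
    also have "\<dots> \<le> bessel_kernel \<nu> x t"
      using cosh_real_ge_1[of "\<nu> * t"] by (simp add: bessel_kernel_def)
    finally show "exp (- x * cosh 1) \<le> bessel_kernel \<nu> x t" .
  qed
  also have "\<dots> \<le> bessel_K \<nu> x"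
    unfolding bessel_K_eq set_lebesgue_integral_def
    using set_integrable_bessel_kernel[OF assms]
      set_integrable_subset[OF set_integrable_bessel_kernel[OF assms], of "{0..1}"]
    by (intro integral_mono)
       (auto simp: set_integrable_def bessel_kernel_nonneg split: split_indicator)
  finally show ?thesis
    by (rule less_le_trans[rotated]) simp
qed

lemma bessel_K_minus: "bessel_K (- \<nu>) x = bessel_K \<nu> x"
  by (simp add: bessel_K_def)

text \<open>The kernels compare pointwise. The later use is for the orders \<nu> - 1 and \<nu>,
  where |\<nu> - 1| \<le> |\<nu>| means \<nu> \<ge> 1/2; this is where that threshold comes
  from.\<close>

lemma bessel_K_mono:
  assumes "x > 0" "\<bar>\<mu>\<bar> \<le> \<bar>\<nu>\<bar>"
  shows "bessel_K \<mu> x \<le> bessel_K \<nu> x"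
  unfolding bessel_K_eq
proof (rule set_integral_mono[OF set_integrable_bessel_kernel set_integrable_bessel_kernel])
  fix t :: real assume "t \<in> {0..}"
  then have "cosh \<bar>\<mu> * t\<bar> \<le> cosh \<bar>\<nu> * t\<bar>"
    using assms(2) by (subst cosh_real_nonneg_le_iff) (auto simp: abs_mult intro: mult_right_mono)
  then show "bessel_kernel \<mu> x t \<le> bessel_kernel \<nu> x t"
    by (simp add: bessel_kernel_def)
qed (use assms in auto)

lemma abs_exp_minus_linear_le: "\<bar>exp z - 1 - z\<bar> \<le> z\<^sup>2 * exp \<bar>z\<bar>" for z :: real
proof -
  obtain t where t: "\<bar>t\<bar> \<le> \<bar>z\<bar>" "exp z = (\<Sum>m<2. z ^ m / fact m) + (exp t / fact 2) * z\<^sup>2"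
    using Maclaurin_exp_le[of z 2] by blast
  then have "exp z - 1 - z = exp t / 2 * z\<^sup>2"
    by (simp add: numeral_2_eq_2)
  moreover have "exp t / 2 \<le> exp \<bar>z\<bar>"
    using t(1) by (smt (verit) exp_gt_zero exp_le_cancel_iff field_sum_of_halves)
  ultimately show ?thesis
    using mult_right_mono[of "exp t / 2" "exp \<bar>z\<bar>" "z\<^sup>2"]
    by (simp only: abs_mult abs_power2 abs_of_pos exp_gt_zero half_gt_zero mult.commute zero_le_power2)
qed

text \<open>Differentiation under the integral sign: the second-order remainder of the integrand is
  dominated by \<open>h\<^sup>2\<close> times an integrable function.\<close>

lemma bessel_K_has_derivative:
  assumes "x > 0"
  shows "(bessel_K \<nu> has_real_derivative - (bessel_K (\<nu> + 1) x + bessel_K (\<nu> - 1) x) / 2) (at x)"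
proof -
  define D where "D = - (bessel_K (\<nu> + 1) x + bessel_K (\<nu> - 1) x) / 2"
  \<comment> \<open>Half of x is given away: for |h| < x/2 the factor exp (|h| cosh t) from the
    Taylor remainder is absorbed, and a kernel with argument x/2 remains.\<close>
  define W where "W t = (cosh t)\<^sup>2 * bessel_kernel \<nu> (x / 2) t" for t
  define M where "M = (LBINT t:{0..}. W t)"
  note I = set_integrable_bessel_kernel
  have Weq: "W = (\<lambda>t. ((bessel_kernel (\<nu> + 1 + 1) (x / 2) t + bessel_kernel (\<nu> + 1 - 1) (x / 2) t) / 2
      + (bessel_kernel (\<nu> - 1 + 1) (x / 2) t + bessel_kernel (\<nu> - 1 - 1) (x / 2) t) / 2) / 2)"
    unfolding W_def power2_eq_square mult.assoc cosh_mult_bessel_kernel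
    by (simp add: distrib_left times_divide_eq_right cosh_mult_bessel_kernel)
  have WI: "set_integrable lborel {0..} W"
    unfolding Weq using assms
    by (intro set_integral_add(1) set_integrable_divide I) auto
  have DI: "set_integrable lborel {0..} (\<lambda>t. cosh t * bessel_kernel \<nu> x t)"
    unfolding cosh_mult_bessel_kernel using assms
    by (intro set_integral_add(1) set_integrable_divide I) auto
  have Deq: "(LBINT t:{0..}. cosh t * bessel_kernel \<nu> x t) = - D"
    unfolding cosh_mult_bessel_kernel D_def bessel_K_eq using assms
    by (simp add: I field_simps)
  have est: "\<bar>(bessel_K \<nu> (x + h) - bessel_K \<nu> x) / h - D\<bar> \<le> M * \<bar>h\<bar>"
    if h: "h \<noteq> 0" "\<bar>h\<bar> < x / 2" for h
  proof -
    have x2: "x + h > 0" using h by linarith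
    define r where "r t = bessel_kernel \<nu> (x + h) t - bessel_kernel \<nu> x t
        + h * (cosh t * bessel_kernel \<nu> x t)" for t
    have rI: "set_integrable lborel {0..} r"
      unfolding r_def using assms x2
      by (intro set_integral_add(1) set_integral_diff(1) I) (auto intro: DI)
    have "\<bar>LBINT t:{0..}. r t\<bar> \<le> (LBINT t:{0..}. h\<^sup>2 * W t)"
    proof (rule order_trans[OF set_integral_norm_bound[OF rI, unfolded real_norm_def]])
      show "(LBINT t:{0..}. \<bar>r t\<bar>) \<le> (LBINT t:{0..}. h\<^sup>2 * W t)"
      proof (rule set_integral_mono)
        show "set_integrable lborel {0..} (\<lambda>t. \<bar>r t\<bar>)"
          using rI by (rule set_integrable_abs)
        show "set_integrable lborel {0..} (\<lambda>t. h\<^sup>2 * W t)"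
          using WI by simp
        fix t :: real
        have "r t = (exp (- h * cosh t) - 1 - (- h * cosh t)) * bessel_kernel \<nu> x t"
          by (simp add: r_def bessel_kernel_def exp_add[symmetric] algebra_simps)
        then have "\<bar>r t\<bar> = \<bar>exp (- h * cosh t) - 1 - (- h * cosh t)\<bar> * bessel_kernel \<nu> x t"
          by (simp only: abs_mult abs_of_nonneg[OF bessel_kernel_nonneg])
        also have "\<dots> \<le> ((- h * cosh t)\<^sup>2 * exp \<bar>- h * cosh t\<bar>) * bessel_kernel \<nu> x t"
          by (intro mult_right_mono abs_exp_minus_linear_le bessel_kernel_nonneg)
        also have "\<dots> = h\<^sup>2 * ((cosh t)\<^sup>2 * (exp (\<bar>h\<bar> * cosh t - x * cosh t) * cosh (\<nu> * t)))"
          by (simp add: bessel_kernel_def power_mult_distrib abs_mult exp_diff exp_minus field_simps)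
        also have "\<dots> \<le> h\<^sup>2 * W t"
        proof -
          have "\<bar>h\<bar> * cosh t \<le> (x / 2) * cosh t"
            using h by (intro mult_right_mono) auto
          then have "exp (\<bar>h\<bar> * cosh t - x * cosh t) \<le> exp (- (x / 2) * cosh t)"
            by (subst exp_le_cancel_iff) linarith
          then show ?thesis
            unfolding W_def bessel_kernel_def
            by (intro mult_left_mono mult_right_mono) auto
        qed
        finally show "\<bar>r t\<bar> \<le> h\<^sup>2 * W t" .
      qed
    qed
    also have "\<dots> = h\<^sup>2 * M" by (simp add: M_def)
    finally have "\<bar>LBINT t:{0..}. r t\<bar> \<le> h\<^sup>2 * M" .
    moreover have "(LBINT t:{0..}. r t) = bessel_K \<nu> (x + h) - bessel_K \<nu> x - h * D"
      unfolding r_def bessel_K_eq using assms x2 DI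
      by (simp add: I Deq)
    ultimately have "\<bar>bessel_K \<nu> (x + h) - bessel_K \<nu> x - h * D\<bar> \<le> \<bar>h\<bar> * (M * \<bar>h\<bar>)"
      by (simp add: power2_eq_square flip: mult.assoc) (simp add: mult_ac)
    moreover have "bessel_K \<nu> (x + h) - bessel_K \<nu> x - h * D
        = h * ((bessel_K \<nu> (x + h) - bessel_K \<nu> x) / h - D)"
      using h by (simp add: field_simps)
    ultimately show ?thesis
      using h by (simp add: abs_mult)
  qed
  have "((\<lambda>h. (bessel_K \<nu> (x + h) - bessel_K \<nu> x) / h - D) \<longlongrightarrow> 0) (at 0)"
  proof (rule Lim_null_comparison)
    show "((\<lambda>h. M * \<bar>h\<bar>) \<longlongrightarrow> 0) (at 0)"
      by (auto intro!: tendsto_eq_intros)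
    have "\<forall>\<^sub>F h in at 0. h \<in> ball 0 (x/2) - {0}"
      using assms by (intro eventually_at_in_open) auto
    then show "\<forall>\<^sub>F h in at 0. norm ((bessel_K \<nu> (x + h) - bessel_K \<nu> x) / h - D) \<le> M * \<bar>h\<bar>"
      by eventually_elim (auto intro!: est)
  qed
  then show ?thesis
    unfolding DERIV_def D_def[symmetric] by (simp add: LIM_zero_iff)
qed

text \<open>The function exp (- x cosh t) sinh (\<nu> t) vanishes at 0 and at infinity, so its
  derivative has integral 0. The product formula for sinh turns that derivative into kernels of
  orders \<nu> and \<nu> \<plusminus> 1.\<close>

lemma bessel_K_rec:
  assumes "x > 0"
  shows "bessel_K (\<nu> + 1) x = bessel_K (\<nu> - 1) x + 2 * \<nu> / x * bessel_K \<nu> x"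
proof -
  note I = set_integrable_bessel_kernel[OF assms]
  define F where "F t = exp (- x * cosh t) * sinh (\<nu> * t)" for t
  define f where "f t = \<nu> * bessel_kernel \<nu> x t
      - x * ((bessel_kernel (\<nu> + 1) x t - bessel_kernel (\<nu> - 1) x t) / 2)" for t
  have f_alt: "f t = \<nu> * bessel_kernel \<nu> x t - x * (sinh t * sinh (\<nu> * t)) * exp (- x * cosh t)" for t
  proof -
    have "sinh t * sinh (\<nu> * t) = (cosh ((\<nu> + 1) * t) - cosh ((\<nu> - 1) * t)) / 2"
      using sinh_mult_sinh[of "\<nu> * t" t] by (simp add: algebra_simps)
    then have "x * (sinh t * sinh (\<nu> * t)) * exp (- x * cosh t)
        = x * ((cosh ((\<nu> + 1) * t) - cosh ((\<nu> - 1) * t)) / 2) * exp (- x * cosh t)"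
      by simp
    then show ?thesis
      by (simp only: f_def bessel_kernel_def) (simp add: algebra_simps diff_divide_distrib)
  qed
  have fI: "set_integrable lborel {0..} f"
    unfolding f_def
    by (intro set_integral_diff(1) set_integrable_mult_right set_integrable_divide I)
  have dF: "(F has_real_derivative f t) (at t)" for t
    unfolding F_def f_alt bessel_kernel_def
    by (auto intro!: derivative_eq_intros simp: algebra_simps)
  have fin: "(LBINT t:{0..b}. f t) = F b" if "b \<ge> 0" for b
  proof -
    have "continuous_on {0..b} f"
      unfolding f_def bessel_kernel_def by (intro continuous_intros) auto
    moreover have "(F has_vector_derivative f t) (at t within {0..b})" for t
      using dF[of t] by (simp add: has_field_derivative_at_within has_real_derivative_iff_has_vector_derivative[symmetric])
    ultimately have "(LBINT t:{0..b}. f t) = F b - F 0"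
      unfolding set_lebesgue_integral_def using that
      by (intro integral_FTC_atLeastAtMost) auto
    then show ?thesis by (simp add: F_def)
  qed
  have "((\<lambda>b. LBINT t:{0..b}. f t) \<longlongrightarrow> (LBINT t:{0..}. f t)) at_top"
    by (rule tendsto_set_lebesgue_integral_at_top[OF _ fI]) auto
  moreover have "((\<lambda>b. LBINT t:{0..b}. f t) \<longlongrightarrow> 0) at_top"
  proof (rule Lim_null_comparison)
    show "\<forall>\<^sub>F b in at_top. norm (LBINT t:{0..b}. f t) \<le> exp ((\<bar>\<nu>\<bar> + 1)\<^sup>2 / x) * exp (- b)"
      using eventually_ge_at_top[of 0]
    proof eventually_elim
      case (elim b)
      have "\<bar>sinh (\<nu> * b)\<bar> \<le> cosh (\<nu> * b)"
        using sinh_less_cosh_real[of "\<nu> * b"] sinh_less_cosh_real[of "- (\<nu> * b)"]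
        by (simp add: abs_le_iff)
      then have "\<bar>F b\<bar> \<le> bessel_kernel \<nu> x b"
        by (simp add: F_def bessel_kernel_def abs_mult mult_left_mono)
      also have "\<dots> \<le> exp ((\<bar>\<nu>\<bar> + 1)\<^sup>2 / x) * exp (- b)"
        using elim by (intro bessel_kernel_le assms)
      finally show ?case using fin[OF elim] by simp
    qed
    show "((\<lambda>b. exp ((\<bar>\<nu>\<bar> + 1)\<^sup>2 / x) * exp (- b)) \<longlongrightarrow> 0) at_top"
      by (intro tendsto_mult_right_zero filterlim_compose[OF exp_at_bot])
         (simp add: filterlim_uminus_at_bot_at_top)
  qed
  ultimately have "(LBINT t:{0..}. f t) = 0"
    using tendsto_unique trivial_limit_at_top_linorder by blast
  then have "\<nu> * bessel_K \<nu> x - x * ((bessel_K (\<nu> + 1) x - bessel_K (\<nu> - 1) x) / 2) = 0"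
    unfolding f_def bessel_K_eq
    by (subst (asm) set_integral_diff(2);
        (intro set_integral_diff(1) set_integrable_mult_right set_integrable_divide I)?)
       (simp add: I)
  then show ?thesis
    using assms by (simp add: field_simps)
qed

subsection \<open>Uniform bounds for higher derivatives\<close>

text \<open>The constant is chosen before the parameter and the point, which is the source of all
  uniformity in c and m. A set of pairs lets the domain of x depend on the parameter.\<close>

definition dominated :: "('p \<times> real) set \<Rightarrow> ('p \<Rightarrow> real \<Rightarrow> real) \<Rightarrow> ('p \<Rightarrow> real \<Rightarrow> real) \<Rightarrow> bool" where
  "dominated S g f \<longleftrightarrow> (\<exists>C. \<forall>p x. (p, x) \<in> S \<longrightarrow> \<bar>f p x\<bar> \<le> C * g p x)"

lemma dominatedI: "(\<And>p x. (p, x) \<in> S \<Longrightarrow> \<bar>f p x\<bar> \<le> C * g p x) \<Longrightarrow> dominated S g f"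
  unfolding dominated_def by blast

lemma dominatedE:
  assumes "dominated S g f"
  obtains C where "\<And>p x. (p, x) \<in> S \<Longrightarrow> \<bar>f p x\<bar> \<le> C * g p x"
  using assms unfolding dominated_def by blast

lemma dominated_mono:
  assumes "dominated S g f" and le: "\<And>p x. (p, x) \<in> S \<Longrightarrow> 0 \<le> g p x \<and> g p x \<le> b * g' p x"
  shows "dominated S g' f"
proof -
  obtain C where C: "\<And>p x. (p, x) \<in> S \<Longrightarrow> \<bar>f p x\<bar> \<le> C * g p x"
    using assms(1) by (rule dominatedE) blast
  show ?thesis
  proof (rule dominatedI[where C = "\<bar>C\<bar> * b"])
    fix p x assume px: "(p, x) \<in> S"
    have "C * g p x \<le> \<bar>C\<bar> * g p x"
      using le[OF px] by (intro mult_right_mono) auto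
    also have "\<dots> \<le> \<bar>C\<bar> * (b * g' p x)"
      using le[OF px] by (intro mult_left_mono) auto
    finally show "\<bar>f p x\<bar> \<le> (\<bar>C\<bar> * b) * g' p x"
      using C[OF px] by (simp add: mult.assoc)
  qed
qed

lemma dominated_add:
  assumes "dominated S g f" "dominated S g h"
  shows "dominated S g (\<lambda>p x. f p x + h p x)"
proof -
  obtain C D where "\<And>p x. (p, x) \<in> S \<Longrightarrow> \<bar>f p x\<bar> \<le> C * g p x" "\<And>p x. (p, x) \<in> S \<Longrightarrow> \<bar>h p x\<bar> \<le> D * g p x"
    using assms by (metis dominatedE)
  then show ?thesis
    by (intro dominatedI[where C = "C + D"])
       (auto simp: distrib_right intro: order_trans[OF abs_triangle_ineq add_mono])
qed

lemma dominated_mult: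
  assumes "dominated S g f" "dominated S k h"
  shows "dominated S (\<lambda>p x. g p x * k p x) (\<lambda>p x. f p x * h p x)"
proof -
  obtain C D where CD: "\<And>p x. (p, x) \<in> S \<Longrightarrow> \<bar>f p x\<bar> \<le> C * g p x" "\<And>p x. (p, x) \<in> S \<Longrightarrow> \<bar>h p x\<bar> \<le> D * k p x"
    using assms by (metis dominatedE)
  show ?thesis
  proof (rule dominatedI[where C = "C * D"])
    fix p x assume px: "(p, x) \<in> S"
    have "\<bar>f p x\<bar> * \<bar>h p x\<bar> \<le> (C * g p x) * (D * k p x)"
      using CD[OF px] by (intro mult_mono') auto
    then show "\<bar>f p x * h p x\<bar> \<le> C * D * (g p x * k p x)"
      by (simp add: abs_mult mult_ac)
  qed
qed

lemma dominated_cmult: "dominated S g f \<Longrightarrow> dominated S g (\<lambda>p x. c * f p x)"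
  unfolding dominated_def
  by (elim exE, rule_tac x = "\<bar>c\<bar> * C" in exI) (auto simp: abs_mult mult.assoc intro: mult_left_mono)

text \<open>\<open>deriv_bound n S w g f\<close>: the derivatives of the members \<open>f p\<close> up to order \<open>n\<close> exist on the
  section of \<open>S\<close> at \<open>p\<close> and the \<open>i\<close>-th one is \<open>O(w\<^sup>i g)\<close>, with a constant independent of \<open>p\<close>.\<close>

primrec deriv_bound :: "nat \<Rightarrow> ('p \<times> real) set \<Rightarrow> ('p \<Rightarrow> real \<Rightarrow> real) \<Rightarrow> ('p \<Rightarrow> real \<Rightarrow> real)
    \<Rightarrow> ('p \<Rightarrow> real \<Rightarrow> real) \<Rightarrow> bool" where
  "deriv_bound 0 S w g f \<longleftrightarrow> dominated S g f"
| "deriv_bound (Suc n) S w g f \<longleftrightarrow> dominated S g f \<and>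
     (\<exists>f'. (\<forall>p x. (p, x) \<in> S \<longrightarrow> (f p has_real_derivative f' p x) (at x)) \<and>
           deriv_bound n S w (\<lambda>p x. w p x * g p x) f')"

lemma deriv_bound_dominated: "deriv_bound n S w g f \<Longrightarrow> dominated S g f"
  by (cases n) auto

lemma deriv_bound_SucI:
  assumes "dominated S g f"
    and "\<And>p x. (p, x) \<in> S \<Longrightarrow> (f p has_real_derivative f' p x) (at x)"
    and "deriv_bound n S w (\<lambda>p x. w p x * g p x) f'"
  shows "deriv_bound (Suc n) S w g f"
  using assms by auto

lemma deriv_bound_SucE:
  assumes "deriv_bound (Suc n) S w g f"
  obtains f' where "dominated S g f"
    "\<And>p x. (p, x) \<in> S \<Longrightarrow> (f p has_real_derivative f' p x) (at x)"
    "deriv_bound n S w (\<lambda>p x. w p x * g p x) f'"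
  using assms by auto

lemma deriv_bound_SucD: "deriv_bound (Suc n) S w g f \<Longrightarrow> deriv_bound n S w g f"
proof (induction n arbitrary: g f)
  case (Suc n)
  from Suc.prems show ?case
    by (rule deriv_bound_SucE) (rule deriv_bound_SucI[OF _ _ Suc.IH])
qed auto

lemma deriv_bound_mono:
  assumes "deriv_bound n S w g f"
    and w: "\<And>p x. (p, x) \<in> S \<Longrightarrow> 0 \<le> w p x \<and> w p x \<le> a * w' p x"
    and "\<And>p x. (p, x) \<in> S \<Longrightarrow> 0 \<le> g p x \<and> g p x \<le> b * g' p x"
  shows "deriv_bound n S w' g' f"
  using assms(1,3)
proof (induction n arbitrary: g g' f b)
  case 0
  then show ?case by (auto intro: dominated_mono)
next
  case (Suc n)
  from Suc.prems(1) show ?case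
  proof (rule deriv_bound_SucE)
    fix f' assume f': "dominated S g f" "\<And>p x. (p, x) \<in> S \<Longrightarrow> (f p has_real_derivative f' p x) (at x)"
      "deriv_bound n S w (\<lambda>p x. w p x * g p x) f'"
    have "deriv_bound n S w' (\<lambda>p x. w' p x * g' p x) f'"
    proof (rule Suc.IH[OF f'(3)])
      fix p x assume px: "(p, x) \<in> S"
      have "w p x * g p x \<le> (a * w' p x) * (b * g' p x)"
        using w[OF px] Suc.prems(2)[OF px] by (intro mult_mono) auto
      then show "0 \<le> w p x * g p x \<and> w p x * g p x \<le> (a * b) * (w' p x * g' p x)"
        using w[OF px] Suc.prems(2)[OF px] by (auto simp: mult_ac)
    qed
    with f' dominated_mono[OF f'(1) Suc.prems(2)] show ?thesis
      by (intro deriv_bound_SucI)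
  qed
qed

lemma deriv_bound_cong:
  assumes "deriv_bound n S w g f"
    and op: "\<And>p. open {x. (p, x) \<in> S}"
    and eq: "\<And>p x. (p, x) \<in> S \<Longrightarrow> f p x = h p x"
  shows "deriv_bound n S w g h"
proof -
  have tr: "(h p has_real_derivative D) (at x)"
    if "(f p has_real_derivative D) (at x)" "(p, x) \<in> S" for p x D
    using has_field_derivative_transform_within_open[OF that(1) op[of p], of "h p"] that(2) eq
    by simp
  have dom: "dominated S g h"
    using deriv_bound_dominated[OF assms(1)] eq by (simp add: dominated_def)
  show ?thesis
  proof (cases n)
    case (Suc m)
    show ?thesis
      using assms(1) unfolding Suc
      by (rule deriv_bound_SucE) (rule deriv_bound_SucI[OF dom tr])
  qed (use dom in simp)
qed

text \<open>Serves two purposes: translation by a parameter-dependent amount, for the terms of the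
  periodization, and, with \<open>a\<close> equal to 0, plain renaming of parameters.\<close>

lemma deriv_bound_subst:
  assumes "deriv_bound n T w g f"
    and sub: "\<And>q x. (q, x) \<in> S \<Longrightarrow> (r q, x + a q) \<in> T"
  shows "deriv_bound n S (\<lambda>q x. w (r q) (x + a q)) (\<lambda>q x. g (r q) (x + a q))
           (\<lambda>q x. f (r q) (x + a q))"
  using assms(1)
proof (induction n arbitrary: g f)
  have dom: "dominated S (\<lambda>q x. g (r q) (x + a q)) (\<lambda>q x. f (r q) (x + a q))"
    if "dominated T g f" for f g
    using that sub unfolding dominated_def by blast
  {
    case 0
    then show ?case using dom by simp
  next
    case (Suc n)
    from Suc.prems show ?case
    proof (rule deriv_bound_SucE)
      fix f' assume "dominated T g f" "deriv_bound n T w (\<lambda>p x. w p x * g p x) f'"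
        "\<And>p x. (p, x) \<in> T \<Longrightarrow> (f p has_real_derivative f' p x) (at x)"
      then show ?thesis
        using sub by (intro deriv_bound_SucI[OF dom _ Suc.IH] DERIV_shift[THEN iffD1]) auto
    qed
  }
qed

lemma deriv_bound_const:
  assumes "\<And>p x. (p, x) \<in> S \<Longrightarrow> 0 \<le> w p x" "\<And>p x. (p, x) \<in> S \<Longrightarrow> 0 \<le> g p x"
    "dominated S g (\<lambda>p x. c p)"
  shows "deriv_bound n S w g (\<lambda>p x. c p)"
proof -
  have zero: "deriv_bound n S w g (\<lambda>p x. 0)"
    if "\<And>p x. (p, x) \<in> S \<Longrightarrow> 0 \<le> g p x" for g n
    using that
  proof (induction n arbitrary: g)
    have dom: "dominated S g (\<lambda>p x. 0)" if "\<And>p x. (p, x) \<in> S \<Longrightarrow> 0 \<le> g p x" for g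
      using that by (intro dominatedI[where C = 1]) simp
    {
      case 0
      then show ?case using dom by simp
    next
      case (Suc n)
      show ?case
      proof (rule deriv_bound_SucI[OF dom])
        show "deriv_bound n S w (\<lambda>p x. w p x * g p x) (\<lambda>p x. 0)"
          using assms(1) Suc.prems by (intro Suc.IH) simp
      qed (simp_all add: Suc.prems)
    }
  qed
  show ?thesis
  proof (cases n)
    case (Suc m)
    show ?thesis
      unfolding Suc
      by (rule deriv_bound_SucI[where f' = "\<lambda>p x. 0", OF assms(3)])
         (auto intro!: assms mult_nonneg_nonneg zero[of "\<lambda>p x. w p x * g p x" for m])
  qed (use assms in simp)
qed

lemma deriv_bound_add:
  assumes "deriv_bound n S w g f" "deriv_bound n S w g h"
  shows "deriv_bound n S w g (\<lambda>p x. f p x + h p x)"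
  using assms
proof (induction n arbitrary: g f h)
  case 0
  then show ?case by (simp add: dominated_add)
next
  case (Suc n)
  obtain f' where f': "\<And>p x. (p, x) \<in> S \<Longrightarrow> (f p has_real_derivative f' p x) (at x)"
    "deriv_bound n S w (\<lambda>p x. w p x * g p x) f'" "dominated S g f"
    using Suc.prems(1) by (rule deriv_bound_SucE) blast
  obtain h' where h': "\<And>p x. (p, x) \<in> S \<Longrightarrow> (h p has_real_derivative h' p x) (at x)"
    "deriv_bound n S w (\<lambda>p x. w p x * g p x) h'" "dominated S g h"
    using Suc.prems(2) by (rule deriv_bound_SucE) blast
  show ?case
    by (rule deriv_bound_SucI[OF dominated_add[OF f'(3) h'(3)] DERIV_add[OF f'(1) h'(1)]
          Suc.IH[OF f'(2) h'(2)]])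
qed

lemma deriv_bound_cmult:
  assumes "deriv_bound n S w g f"
  shows "deriv_bound n S w g (\<lambda>p x. c * f p x)"
  using assms
proof (induction n arbitrary: g f)
  case 0
  then show ?case by (simp add: dominated_cmult)
next
  case (Suc n)
  from Suc.prems show ?case
    by (rule deriv_bound_SucE) (rule deriv_bound_SucI[OF dominated_cmult DERIV_cmult Suc.IH])
qed

text \<open>Each derivative costs one factor \<open>w\<close>, whichever of the two factors it hits;
  hence both terms of the Leibniz rule have the majorant w g k.\<close>

lemma deriv_bound_mult:
  assumes "deriv_bound n S w g f" "deriv_bound n S w k h"
  shows "deriv_bound n S w (\<lambda>p x. g p x * k p x) (\<lambda>p x. f p x * h p x)"
  using assms
proof (induction n arbitrary: g f k h)
  case 0
  then show ?case by (simp add: dominated_mult)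
next
  case (Suc n)
  obtain f' where f': "\<And>p x. (p, x) \<in> S \<Longrightarrow> (f p has_real_derivative f' p x) (at x)"
    "deriv_bound n S w (\<lambda>p x. w p x * g p x) f'" "dominated S g f"
    using Suc.prems(1) by (rule deriv_bound_SucE) blast
  obtain h' where h': "\<And>p x. (p, x) \<in> S \<Longrightarrow> (h p has_real_derivative h' p x) (at x)"
    "deriv_bound n S w (\<lambda>p x. w p x * k p x) h'" "dominated S k h"
    using Suc.prems(2) by (rule deriv_bound_SucE) blast
  show ?case
  proof (rule deriv_bound_SucI[OF dominated_mult[OF f'(3) h'(3)] DERIV_mult[OF f'(1) h'(1)]])
    show "deriv_bound n S w (\<lambda>p x. w p x * (g p x * k p x)) (\<lambda>p x. f' p x * h p x + h' p x * f p x)"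
      using Suc.IH[OF f'(2) deriv_bound_SucD[OF Suc.prems(2)]]
        Suc.IH[OF h'(2) deriv_bound_SucD[OF Suc.prems(1)]]
      by (intro deriv_bound_add) (simp_all add: mult_ac)
  qed
qed

text \<open>The derivative - f' / f^2 has majorant w g / g^2 = w / g once |f| is comparable to
  \<open>g\<close> from below; the bounds for 1 / f of the lower order come from the
  induction.\<close>

lemma deriv_bound_inverse:
  assumes "deriv_bound n S w g f"
    and w: "\<And>p x. (p, x) \<in> S \<Longrightarrow> 0 \<le> w p x"
    and g: "\<And>p x. (p, x) \<in> S \<Longrightarrow> 0 < g p x \<and> g p x \<le> c * \<bar>f p x\<bar>"
  shows "deriv_bound n S w (\<lambda>p x. inverse (g p x)) (\<lambda>p x. inverse (f p x))"
  using assms(1)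
proof (induction n)
  have nz: "f p x \<noteq> 0" if "(p, x) \<in> S" for p x
    using g[OF that] by auto
  have dom: "dominated S (\<lambda>p x. inverse (g p x)) (\<lambda>p x. inverse (f p x))"
  proof (rule dominatedI)
    fix p x assume px: "(p, x) \<in> S"
    show "\<bar>inverse (f p x)\<bar> \<le> c * inverse (g p x)"
      using g[OF px] nz[OF px] by (simp add: field_simps)
  qed
  {
    case 0
    then show ?case using dom by simp
  next
    case (Suc n)
    obtain f' where f': "\<And>p x. (p, x) \<in> S \<Longrightarrow> (f p has_real_derivative f' p x) (at x)"
      "deriv_bound n S w (\<lambda>p x. w p x * g p x) f'" "dominated S g f"
      using Suc.prems(1) by (rule deriv_bound_SucE) blast
    note I = Suc.IH[OF deriv_bound_SucD[OF Suc.prems]]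
    have "deriv_bound n S w (\<lambda>p x. w p x * g p x * inverse (g p x) * inverse (g p x))
        (\<lambda>p x. - 1 * (f' p x * inverse (f p x) * inverse (f p x)))"
      by (intro deriv_bound_cmult deriv_bound_mult f' I)
    then have "deriv_bound n S w (\<lambda>p x. w p x * inverse (g p x))
        (\<lambda>p x. - 1 * (f' p x * inverse (f p x) * inverse (f p x)))"
    proof (rule deriv_bound_mono[where a = 1 and b = 1])
      fix p x assume px: "(p, x) \<in> S"
      show "0 \<le> w p x * g p x * inverse (g p x) * inverse (g p x) \<and>
          w p x * g p x * inverse (g p x) * inverse (g p x) \<le> 1 * (w p x * inverse (g p x))"
        using g[OF px] w[OF px] by (simp add: field_simps)
    qed (simp add: w)
    with f'(1) nz show ?case
      by (intro deriv_bound_SucI[OF dom]) (auto intro!: derivative_eq_intros)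
  }
qed

text \<open>Indexing the terms by pairs (p, j) makes their constants independent of j. The weight
  depends on p alone, so it can be pulled out of the sum, and the majorant \<open>M\<close>, uniform
  in x, gives uniform convergence of the differentiated series.\<close>

lemma deriv_bound_suminf:
  fixes f :: "'p \<times> nat \<Rightarrow> real \<Rightarrow> real"
  assumes "deriv_bound n {(q, x). (fst q, x) \<in> S} (\<lambda>q x. \<omega> (fst q)) g f"
    and S: "\<And>p. convex {x. (p, x) \<in> S}" "\<And>p. open {x. (p, x) \<in> S}"
    and \<omega>: "\<And>p x. (p, x) \<in> S \<Longrightarrow> 0 \<le> \<omega> p"
    and "\<And>p j x. (p, x) \<in> S \<Longrightarrow> 0 \<le> g (p, j) x"
    and "\<And>p j x. (p, x) \<in> S \<Longrightarrow> g (p, j) x \<le> M p j"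
    and "\<And>p x. (p, x) \<in> S \<Longrightarrow> summable (M p)"
  shows "deriv_bound n S (\<lambda>p x. \<omega> p) (\<lambda>p x. \<Sum>j. g (p, j) x) (\<lambda>p x. \<Sum>j. f (p, j) x)"
  using assms(1,5-)
proof (induction n arbitrary: f g M)
  let ?T = "{(q, x). (fst q, x) \<in> S} :: (('p \<times> nat) \<times> real) set"
  have summ_g: "summable (\<lambda>j. g (p, j) x)"
    if "\<And>j. 0 \<le> g (p, j) x" "\<And>j. g (p, j) x \<le> M p j" "summable (M p)"
    for p x and M :: "'p \<Rightarrow> nat \<Rightarrow> real" and g :: "'p \<times> nat \<Rightarrow> real \<Rightarrow> real"
  proof (rule summable_comparison_test'[OF that(3)])
    show "norm (g (p, j) x) \<le> M p j" if "j \<ge> 0" for j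
      unfolding real_norm_def abs_of_nonneg[OF \<open>\<And>j. 0 \<le> g (p, j) x\<close>] by fact
  qed
  have dom: "dominated S (\<lambda>p x. \<Sum>j. g (p, j) x) (\<lambda>p x. \<Sum>j. f (p, j) x)"
    if dm: "dominated ?T g f"
      and gM: "\<And>p j x. (p, x) \<in> S \<Longrightarrow> 0 \<le> g (p, j) x" "\<And>p j x. (p, x) \<in> S \<Longrightarrow> g (p, j) x \<le> M p j"
      "\<And>p x. (p, x) \<in> S \<Longrightarrow> summable (M p)" for f g M
  proof -
    obtain C where C: "\<And>q x. (q, x) \<in> ?T \<Longrightarrow> \<bar>f q x\<bar> \<le> C * g q x"
      using dm by (rule dominatedE) blast
    show ?thesis
    proof (rule dominatedI[where C = C])
      fix p x assume px: "(p, x) \<in> S"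
      have s: "summable (\<lambda>j. g (p, j) x)"
        by (rule summ_g[of g p x M, OF gM[OF px]])
      have "norm (\<Sum>j. f (p, j) x) \<le> (\<Sum>j. C * g (p, j) x)"
        using C px by (intro norm_suminf_le summable_mult s) simp
      then show "\<bar>\<Sum>j. f (p, j) x\<bar> \<le> C * (\<Sum>j. g (p, j) x)"
        by (simp add: suminf_mult[OF s])
    qed
  qed
  {
    case 0
    then show ?case using dom[of g f M] by simp
  next
    case (Suc n)
    obtain f' where f': "\<And>q x. (q, x) \<in> ?T \<Longrightarrow> (f q has_real_derivative f' q x) (at x)"
      "deriv_bound n ?T (\<lambda>q x. \<omega> (fst q)) (\<lambda>q x. \<omega> (fst q) * g q x) f'"
      "dominated ?T g f"
      using Suc.prems(1) by (rule deriv_bound_SucE) blast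
    have g1: "0 \<le> \<omega> (fst (p, j)) * g (p, j) x" 
      "\<omega> (fst (p, j)) * g (p, j) x \<le> \<omega> p * M p j" if "(p, x) \<in> S" for p j x
      using Suc.prems(2,3)[OF that, of j] \<omega>[OF that] by (auto intro: mult_left_mono)
    have M1: "summable (\<lambda>j. \<omega> p * M p j)" if "(p, x) \<in> S" for p x
      using Suc.prems(4)[OF that] by (rule summable_mult)
    have summ: "summable (\<lambda>j. g (p, j) x)" if "(p, x) \<in> S" for p x
      by (rule summ_g[of g p x M, OF Suc.prems(2,3,4)[OF that]])
    have "deriv_bound n S (\<lambda>p x. \<omega> p)
        (\<lambda>p x. \<Sum>j. \<omega> (fst (p, j)) * g (p, j) x) (\<lambda>p x. \<Sum>j. f' (p, j) x)"
      by (rule Suc.IH[OF f'(2) g1 M1])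
    then have 1: "deriv_bound n S (\<lambda>p x. \<omega> p)
        (\<lambda>p x. \<omega> p * (\<Sum>j. g (p, j) x)) (\<lambda>p x. \<Sum>j. f' (p, j) x)"
    proof (rule deriv_bound_mono[where a = 1 and b = 1])
      fix p x assume px: "(p, x) \<in> S"
      have "0 \<le> (\<Sum>j. g (p, j) x)"
        using Suc.prems(2)[OF px] by (intro suminf_nonneg summ px)
      then show "0 \<le> (\<Sum>j. \<omega> (fst (p, j)) * g (p, j) x) \<and>
          (\<Sum>j. \<omega> (fst (p, j)) * g (p, j) x) \<le> 1 * (\<omega> p * (\<Sum>j. g (p, j) x))"
        using \<omega>[OF px] suminf_mult[OF summ[OF px], of "\<omega> p"] by simp
    qed (use \<omega> in simp)
    obtain C where C: "\<And>q x. (q, x) \<in> ?T \<Longrightarrow> \<bar>f q x\<bar> \<le> C * g q x"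
      using f'(3) by (rule dominatedE) blast
    obtain D where D: "\<And>q x. (q, x) \<in> ?T \<Longrightarrow> \<bar>f' q x\<bar> \<le> D * (\<omega> (fst q) * g q x)"
      using deriv_bound_dominated[OF f'(2)] by (rule dominatedE) blast
    have 2: "((\<lambda>x. \<Sum>j. f (p, j) x) has_real_derivative (\<Sum>j. f' (p, j) x)) (at x)"
      if px: "(p, x) \<in> S" for p x
    proof (rule has_field_derivative_series'(2)[where S = "{x. (p, x) \<in> S}" and ?x0.0 = x])
      show "convex {x. (p, x) \<in> S}" by (rule S)
      show "((\<lambda>x. f (p, j) x) has_real_derivative f' (p, j) y) (at y within {x. (p, x) \<in> S})"
        if "y \<in> {x. (p, x) \<in> S}" for j y
        using that f'(1)[of "(p, j)" y] by (simp add: has_field_derivative_at_within)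
      show "uniformly_convergent_on {x. (p, x) \<in> S} (\<lambda>n x. \<Sum>i<n. f' (p, i) x)"
      proof (rule Weierstrass_m_test')
        show "summable (\<lambda>j. \<bar>D\<bar> * (\<omega> p * M p j))"
          using M1[OF px] by (rule summable_mult)
        fix j y assume "y \<in> {x. (p, x) \<in> S}"
        then have y: "(p, y) \<in> S" by simp
        have "\<bar>f' (p, j) y\<bar> \<le> D * (\<omega> p * g (p, j) y)"
          using D[of "(p, j)" y] y by simp
        also have "\<dots> \<le> \<bar>D\<bar> * (\<omega> p * g (p, j) y)"
          using g1(1)[OF y, of j] by (intro mult_right_mono) auto
        also have "\<dots> \<le> \<bar>D\<bar> * (\<omega> p * M p j)"
          using g1(2)[OF y, of j] by (intro mult_left_mono[of "\<omega> p * g (p, j) y"]) auto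
        finally show "norm (f' (p, j) y) \<le> \<bar>D\<bar> * (\<omega> p * M p j)" by simp
      qed
      show "summable (\<lambda>j. f (p, j) x)"
      proof (rule summable_comparison_test'[where N = 0])
        show "summable (\<lambda>j. C * g (p, j) x)"
          by (intro summable_mult summ px)
        show "norm (f (p, j) x) \<le> C * g (p, j) x" for j
          using C[of "(p, j)" x] px by simp
      qed
      show "x \<in> interior {x. (p, x) \<in> S}"
        using px S(2)[of p] by (simp add: interior_open)
    qed (use px in auto)
    show ?case
      by (rule deriv_bound_SucI[OF dom[OF f'(3) Suc.prems(2,3,4)] 2 1])
  }
qed

section \<open>From chains of derivatives to iterated \<open>deriv\<close>\<close>

lemma deriv_bound_higher_deriv:
  assumes "deriv_bound n S w g f" "\<And>p. open {x. (p, x) \<in> S}"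
  shows "dominated S (\<lambda>p x. w p x ^ n * g p x) (\<lambda>p. (deriv ^^ n) (f p))"
  using assms(1)
proof (induction n arbitrary: f g)
  case (Suc n)
  obtain f' where f': "\<And>p x. (p, x) \<in> S \<Longrightarrow> (f p has_real_derivative f' p x) (at x)"
    "deriv_bound n S w (\<lambda>p x. w p x * g p x) f'" "dominated S g f"
    using Suc.prems(1) by (rule deriv_bound_SucE) blast
  have "(deriv ^^ n) (f' p) x = (deriv ^^ Suc n) (f p) x" if "(p, x) \<in> S" for p x
    unfolding funpow_Suc_right o_apply
  proof (rule higher_deriv_cong_ev[OF _ refl])
    have "eventually (\<lambda>y. y \<in> {x. (p, x) \<in> S}) (nhds x)"
      using that assms(2) by (intro eventually_nhds_in_open) auto
    then show "\<forall>\<^sub>F x in nhds x. f' p x = deriv (f p) x"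
      by eventually_elim (use f'(1) DERIV_imp_deriv in \<open>fastforce\<close>)
  qed
  then show ?case
    using Suc.IH[OF f'(2)] unfolding dominated_def by (simp add: mult_ac)
qed simp

text \<open>\<open>deriv\<close> is total and says nothing where no derivative exists, so existence
  has to be recorded separately from the bounds.\<close>

lemma deriv_bound_differentiable:
  assumes "deriv_bound (Suc n) S w g f" "\<And>p. open {x. (p, x) \<in> S}" "(p, x) \<in> S"
  shows "(deriv ^^ n) (f p) differentiable at x"
  using assms(1)
proof (induction n arbitrary: f g)
  case 0
  then show ?case using assms(3) by (auto simp: real_differentiable_def)
next
  case (Suc n)
  obtain f' where f': "\<And>p x. (p, x) \<in> S \<Longrightarrow> (f p has_real_derivative f' p x) (at x)"
    "deriv_bound (Suc n) S w (\<lambda>p x. w p x * g p x) f'" "dominated S g f"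
    using Suc.prems(1) by (rule deriv_bound_SucE) blast
  have ev: "eventually (\<lambda>y. y \<in> {x. (p, x) \<in> S}) (nhds x)"
    using assms(2,3) by (intro eventually_nhds_in_open) auto
  then have "eventually (\<lambda>y. f' p y = deriv (f p) y) (nhds x)"
    by eventually_elim (use f'(1) DERIV_imp_deriv in \<open>fastforce\<close>)
  then have "eventually (\<lambda>z. eventually (\<lambda>y. f' p y = deriv (f p) y) (nhds z)) (nhds x)"
    by (simp only: eventually_eventually)
  then have "eventually (\<lambda>y. (deriv ^^ n) (f' p) y = (deriv ^^ Suc n) (f p) y) (nhds x)"
    unfolding funpow_Suc_right o_apply
    by eventually_elim (rule higher_deriv_cong_ev[OF _ refl])
  moreover obtain D where "((deriv ^^ n) (f' p) has_real_derivative D) (at x)"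
    using Suc.IH[OF f'(2)] by (auto simp: real_differentiable_def)
  ultimately have "((deriv ^^ Suc n) (f p) has_real_derivative D) (at x)"
    using DERIV_cong_ev by blast
  then show ?case by (auto simp: real_differentiable_def)
qed

subsection \<open>Singularities of Euler type\<close>

text \<open>An identity on a punctured neighbourhood holds near each of its points and may therefore
  be differentiated there.\<close>

lemma eventually_at_nhds:
  fixes a :: "'a :: t1_space"
  assumes "eventually P (at a)"
  shows "eventually (\<lambda>x. eventually P (nhds x)) (at a)"
proof -
  obtain S where S: "open S" "a \<in> S" "\<And>x. x \<in> S \<Longrightarrow> x \<noteq> a \<Longrightarrow> P x"
    using assms unfolding eventually_at_topological by auto
  have "eventually P (nhds x)" if "x \<in> S" "x \<noteq> a" for x
    using S that unfolding eventually_nhds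
    by (intro exI[of _ "S - {a}"]) auto
  then show ?thesis
    using S unfolding eventually_at_topological by auto
qed

text \<open>Functions on a punctured neighbourhood of \<open>0\<close> with limit \<open>l\<close> at \<open>0\<close> whose iterates under the
  Euler operator \<open>f \<mapsto> x f'\<close>, up to order \<open>n\<close>, tend to \<open>0\<close>. In contrast to \<open>C\<^sup>n\<close> functions they
  include \<open>\<bar>x\<bar>\<^sup>a\<close> for every \<open>a > 0\<close> and \<open>x\<^sup>\<nu> K\<^sub>\<nu>(x)\<close>.\<close>

primrec euler_lim :: "nat \<Rightarrow> real \<Rightarrow> (real \<Rightarrow> real) \<Rightarrow> bool" where
  "euler_lim 0 l f \<longleftrightarrow> (f \<longlongrightarrow> l) (at 0)"
| "euler_lim (Suc n) l f \<longleftrightarrow> (f \<longlongrightarrow> l) (at 0) \<and>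
     (\<exists>f'. (\<forall>\<^sub>F x in at 0. (f has_real_derivative f' x) (at x)) \<and> euler_lim n 0 (\<lambda>x. x * f' x))"

lemma euler_lim_tendsto: "euler_lim n l f \<Longrightarrow> (f \<longlongrightarrow> l) (at 0)"
  by (cases n) auto

lemma euler_lim_SucI:
  assumes "(f \<longlongrightarrow> l) (at 0)" "\<forall>\<^sub>F x in at 0. (f has_real_derivative f' x) (at x)"
    "euler_lim n 0 (\<lambda>x. x * f' x)"
  shows "euler_lim (Suc n) l f"
  using assms by auto

lemma euler_lim_SucE:
  assumes "euler_lim (Suc n) l f"
  obtains f' where "(f \<longlongrightarrow> l) (at 0)" "\<forall>\<^sub>F x in at 0. (f has_real_derivative f' x) (at x)"
    "euler_lim n 0 (\<lambda>x. x * f' x)"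
  using assms by auto

lemma euler_lim_SucD: "euler_lim (Suc n) l f \<Longrightarrow> euler_lim n l f"
proof (induction n arbitrary: l f)
  case (Suc n)
  from Suc.prems show ?case
    by (rule euler_lim_SucE) (rule euler_lim_SucI[OF _ _ Suc.IH])
qed auto

lemma euler_lim_cong:
  assumes "euler_lim n l f" and ev: "\<forall>\<^sub>F x in at 0. f x = g x"
  shows "euler_lim n l g"
proof -
  have lim: "(g \<longlongrightarrow> l) (at 0)"
    using euler_lim_tendsto[OF assms(1)] tendsto_cong[OF ev] by blast
  show ?thesis
  proof (cases n)
    case (Suc m)
    obtain f' where f': "\<forall>\<^sub>F x in at 0. (f has_real_derivative f' x) (at x)"
      "euler_lim m 0 (\<lambda>x. x * f' x)"
      using assms(1) unfolding Suc by (rule euler_lim_SucE) blast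
    have "\<forall>\<^sub>F x in at 0. (g has_real_derivative f' x) (at x)"
      using f'(1) eventually_at_nhds[OF ev]
      by eventually_elim (use DERIV_cong_ev in blast)
    then show ?thesis
      unfolding Suc by (rule euler_lim_SucI[OF lim _ f'(2)])
  qed (use lim in simp)
qed

lemma euler_lim_const: "euler_lim n c (\<lambda>x. c)"
proof (induction n arbitrary: c)
  case (Suc n)
  show ?case
    by (rule euler_lim_SucI[where f' = "\<lambda>x. 0"]) (use Suc[of 0] in auto)
qed auto

lemma euler_lim_ident: "euler_lim n 0 (\<lambda>x. x)"
proof (induction n)
  case (Suc n)
  show ?case
    by (rule euler_lim_SucI[where f' = "\<lambda>x. 1"]) (use Suc in auto)
qed auto

lemma euler_lim_add:
  assumes "euler_lim n l f" "euler_lim n m g"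
  shows "euler_lim n (l + m) (\<lambda>x. f x + g x)"
  using assms
proof (induction n arbitrary: l m f g)
  case 0
  then show ?case by (auto intro: tendsto_add)
next
  case (Suc n)
  obtain f' where f': "\<forall>\<^sub>F x in at 0. (f has_real_derivative f' x) (at x)"
    "euler_lim n 0 (\<lambda>x. x * f' x)"
    using Suc.prems(1) by (rule euler_lim_SucE) blast
  obtain g' where g': "\<forall>\<^sub>F x in at 0. (g has_real_derivative g' x) (at x)"
    "euler_lim n 0 (\<lambda>x. x * g' x)"
    using Suc.prems(2) by (rule euler_lim_SucE) blast
  show ?case
  proof (rule euler_lim_SucI)
    show "((\<lambda>x. f x + g x) \<longlongrightarrow> l + m) (at 0)"
      by (intro tendsto_add Suc.prems[THEN euler_lim_tendsto])
    show "\<forall>\<^sub>F x in at 0. ((\<lambda>x. f x + g x) has_real_derivative f' x + g' x) (at x)"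
      using f'(1) g'(1) by eventually_elim (rule DERIV_add)
    show "euler_lim n 0 (\<lambda>x. x * (f' x + g' x))"
      using Suc.IH[OF f'(2) g'(2)] by (simp add: distrib_left)
  qed
qed

text \<open>The Euler operator is a derivation, and x f' and x g' tend to 0 while \<open>f\<close>
  and \<open>g\<close> stay bounded near 0.\<close>

lemma euler_lim_mult:
  assumes "euler_lim n l f" "euler_lim n m g"
  shows "euler_lim n (l * m) (\<lambda>x. f x * g x)"
  using assms
proof (induction n arbitrary: l m f g)
  case 0
  then show ?case by (auto intro: tendsto_mult)
next
  case (Suc n)
  obtain f' where f': "\<forall>\<^sub>F x in at 0. (f has_real_derivative f' x) (at x)"
    "euler_lim n 0 (\<lambda>x. x * f' x)"
    using Suc.prems(1) by (rule euler_lim_SucE) blast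
  obtain g' where g': "\<forall>\<^sub>F x in at 0. (g has_real_derivative g' x) (at x)"
    "euler_lim n 0 (\<lambda>x. x * g' x)"
    using Suc.prems(2) by (rule euler_lim_SucE) blast
  show ?case
  proof (rule euler_lim_SucI)
    show "((\<lambda>x. f x * g x) \<longlongrightarrow> l * m) (at 0)"
      by (intro tendsto_mult Suc.prems[THEN euler_lim_tendsto])
    show "\<forall>\<^sub>F x in at 0. ((\<lambda>x. f x * g x) has_real_derivative f' x * g x + g' x * f x) (at x)"
      using f'(1) g'(1) by eventually_elim (rule DERIV_mult)
    have "euler_lim n (0 * m + 0 * l) (\<lambda>x. x * f' x * g x + x * g' x * f x)"
      by (intro euler_lim_add Suc.IH f' g' Suc.prems[THEN euler_lim_SucD])
    then show "euler_lim n 0 (\<lambda>x. x * (f' x * g x + g' x * f x))"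
      by (simp add: distrib_left mult.assoc)
  qed
qed

lemma euler_lim_cmult: "euler_lim n l f \<Longrightarrow> euler_lim n (c * l) (\<lambda>x. c * f x)"
  by (rule euler_lim_mult[OF euler_lim_const])

lemma euler_lim_inverse:
  assumes "euler_lim n l f" "l \<noteq> 0"
  shows "euler_lim n (inverse l) (\<lambda>x. inverse (f x))"
  using assms(1)
proof (induction n)
  case 0
  then show ?case using assms(2) by (auto intro: tendsto_inverse)
next
  case (Suc n)
  obtain f' where f': "\<forall>\<^sub>F x in at 0. (f has_real_derivative f' x) (at x)"
    "euler_lim n 0 (\<lambda>x. x * f' x)"
    using Suc.prems(1) by (rule euler_lim_SucE) blast
  have lim: "(f \<longlongrightarrow> l) (at 0)"
    using Suc.prems by (rule euler_lim_tendsto)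
  note I = Suc.IH[OF euler_lim_SucD[OF Suc.prems]]
  show ?case
  proof (rule euler_lim_SucI)
    show "((\<lambda>x. inverse (f x)) \<longlongrightarrow> inverse l) (at 0)"
      using lim assms(2) by (rule tendsto_inverse)
    show "\<forall>\<^sub>F x in at 0. ((\<lambda>x. inverse (f x)) has_real_derivative
        - (inverse (f x) * f' x * inverse (f x))) (at x)"
      using f'(1) tendsto_imp_eventually_ne[OF lim assms(2)]
      by eventually_elim (rule DERIV_inverse')
    have "euler_lim n (- 1 * (0 * (inverse l * inverse l)))
        (\<lambda>x. - 1 * (x * f' x * (inverse (f x) * inverse (f x))))"
      by (intro euler_lim_cmult euler_lim_mult f' I)
    then show "euler_lim n 0 (\<lambda>x. x * - (inverse (f x) * f' x * inverse (f x)))"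
      by (simp add: mult_ac)
  qed
qed

lemma has_real_derivative_abs_powr:
  fixes x :: real
  assumes "x \<noteq> 0"
  shows "((\<lambda>x. \<bar>x\<bar> powr a) has_real_derivative a * \<bar>x\<bar> powr a / x) (at x)"
proof (cases "x > 0")
  case True
  have "((\<lambda>x. x powr a) has_real_derivative a * \<bar>x\<bar> powr a / x) (at x)"
    using True by (auto intro!: derivative_eq_intros simp: powr_diff)
  then show ?thesis
    by (rule has_field_derivative_transform_within_open[of _ _ _ "{0<..}"]) (use True in auto)
next
  case False
  with assms have "x < 0" by simp
  then have "((\<lambda>x. (- x) powr a) has_real_derivative a * \<bar>x\<bar> powr a / x) (at x)"
    by (auto intro!: derivative_eq_intros simp: powr_diff field_simps)
  then show ?thesis
    by (rule has_field_derivative_transform_within_open[of _ _ _ "{..<0}"]) (use \<open>x < 0\<close> in auto)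
qed

text \<open>The function is an eigenfunction of the Euler operator with eigenvalue
  \<open>a\<close>.\<close>

lemma euler_lim_abs_powr:
  assumes "a > 0" shows "euler_lim n 0 (\<lambda>x. \<bar>x\<bar> powr a)"
proof (induction n)
  have lim: "((\<lambda>x::real. \<bar>x\<bar> powr a) \<longlongrightarrow> 0) (at 0)"
    using assms by (intro tendsto_zero_powrI[OF _ tendsto_const]) (auto intro!: tendsto_eq_intros)
  {
    case 0
    then show ?case using lim by simp
  next
    case (Suc n)
    show ?case
    proof (rule euler_lim_SucI[OF lim])
      show "\<forall>\<^sub>F x in at 0. ((\<lambda>x. \<bar>x\<bar> powr a) has_real_derivative a * \<bar>x\<bar> powr a / x) (at x)"
        using eventually_neq_at_within[of 0] by eventually_elim (rule has_real_derivative_abs_powr)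
      have "euler_lim n 0 (\<lambda>x. a * \<bar>x\<bar> powr a)"
        using euler_lim_cmult[OF Suc.IH] by simp
      then show "euler_lim n 0 (\<lambda>x. x * (a * \<bar>x\<bar> powr a / x))"
        by (rule euler_lim_cong) (auto simp: eventually_at_filter)
    qed
  }
qed

text \<open>Here 0 is an interior point of the section, so the derivatives have limits at 0 and the
  factor x in the Euler operator sends the iterates to 0. One spare derivative provides the
  continuity.\<close>

lemma deriv_bound_imp_euler_lim:
  assumes "deriv_bound (Suc n) S w g f" "open {x. (p, x) \<in> S}" "(p, 0) \<in> S"
  shows "euler_lim n (f p 0) (f p)"
  using assms(1)
proof (induction n arbitrary: f g)
  have lim: "(f p \<longlongrightarrow> f p 0) (at 0)" if "deriv_bound (Suc n) S w g f" for f g n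
  proof -
    obtain D where "(f p has_real_derivative D) (at 0)"
      using \<open>deriv_bound (Suc n) S w g f\<close> by (rule deriv_bound_SucE) (use assms(3) in blast)
    then show ?thesis
      by (rule DERIV_isCont[unfolded isCont_def])
  qed
  {
    case 0
    then show ?case using lim[OF 0] by simp
  next
    case (Suc n)
    obtain f' where f': "\<And>p x. (p, x) \<in> S \<Longrightarrow> (f p has_real_derivative f' p x) (at x)"
      "deriv_bound (Suc n) S w (\<lambda>p x. w p x * g p x) f'"
      using Suc.prems(1) by (rule deriv_bound_SucE) blast
    show ?case
    proof (rule euler_lim_SucI[OF lim[OF Suc.prems]])
      have "\<forall>\<^sub>F x in at 0. x \<in> {x. (p, x) \<in> S}"
        using assms by (intro eventually_at_in_open') auto
      then show "\<forall>\<^sub>F x in at 0. (f p has_real_derivative f' p x) (at x)"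
        by eventually_elim (simp add: f'(1))
      show "euler_lim n 0 (\<lambda>x. x * f' p x)"
        using euler_lim_mult[OF euler_lim_ident Suc.IH[OF f'(2)]] by simp
    qed
  }
qed

text \<open>The \<open>j\<close>-th derivative of \<open>\<bar>x\<bar>\<^sup>a U\<close> is \<open>\<bar>x\<bar>\<^sup>a x\<^bsup>-j\<^esup> V\<close> with \<open>V\<close> of the same kind as \<open>U\<close>, hence
  \<open>o(x)\<close> if \<open>j + 1 < a\<close>. If \<open>j + 1 = a\<close> is even, then \<open>\<bar>x\<bar>\<^sup>a x\<^bsup>-j-1\<^esup> = 1\<close>.\<close>

lemma higher_deriv_abs_powr_mult:
  assumes "\<forall>\<^sub>F x in at 0. f x = \<bar>x\<bar> powr a * U x" "euler_lim k l U" "j \<le> k"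
  shows "\<exists>m V. euler_lim (k - j) m V \<and> (\<forall>\<^sub>F x in at 0. (deriv ^^ j) f x = \<bar>x\<bar> powr a * V x / x ^ j)"
  using assms(3)
proof (induction j)
  case 0
  then show ?case using assms by auto
next
  case (Suc j)
  then obtain m V where V: "euler_lim (Suc (k - Suc j)) m V"
    "\<forall>\<^sub>F x in at 0. (deriv ^^ j) f x = \<bar>x\<bar> powr a * V x / x ^ j"
    by (auto simp: Suc_diff_Suc)
  obtain V' where V': "\<forall>\<^sub>F x in at 0. (V has_real_derivative V' x) (at x)"
    "euler_lim (k - Suc j) 0 (\<lambda>x. x * V' x)"
    using V(1) by (rule euler_lim_SucE) blast
  \<comment> \<open>The outcome of differentiating |x|^a V / x^j and extracting |x|^a / x^(j+1): a
    combination of \<open>V\<close> and its Euler derivative, so one order is used up.\<close>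
  define V1 where "V1 x = (a - real j) * V x + x * V' x" for x
  have "euler_lim (k - Suc j) ((a - real j) * m + 0) V1"
    unfolding V1_def by (intro euler_lim_add euler_lim_cmult euler_lim_SucD[OF V(1)] V')
  moreover have "\<forall>\<^sub>F x in at 0. (deriv ^^ Suc j) f x = \<bar>x\<bar> powr a * V1 x / x ^ Suc j"
    using eventually_at_nhds[OF V(2)] V'(1) eventually_neq_at_within[of 0]
  proof eventually_elim
    case (elim x)
    have "((\<lambda>x. \<bar>x\<bar> powr a * V x / x ^ j) has_real_derivative \<bar>x\<bar> powr a * V1 x / x ^ Suc j) (at x)"
    proof (rule DERIV_cong[OF DERIV_divide[OF DERIV_mult[OF has_real_derivative_abs_powr[OF elim(3)] elim(2)] DERIV_pow]])
      show "x ^ j \<noteq> 0" using elim(3) by simp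
      show "((a * \<bar>x\<bar> powr a / x * V x + V' x * \<bar>x\<bar> powr a) * x ^ j -
          \<bar>x\<bar> powr a * V x * (real j * x ^ (j - Suc 0))) / (x ^ j * x ^ j)
          = \<bar>x\<bar> powr a * V1 x / x ^ Suc j"
        using elim(3) by (cases j) (simp_all add: V1_def field_simps)
    qed
    then show ?case
      using deriv_cong_ev[OF elim(1) refl] by (simp add: DERIV_imp_deriv)
  qed
  ultimately show ?case by blast
qed

lemma higher_deriv_differentiable_abs_powr_mult:
  assumes f: "\<forall>\<^sub>F x in at 0. f x = \<bar>x\<bar> powr a * U x" "f 0 = 0"
    and U: "euler_lim k l U"
    and k: "real k \<le> a" "real k = a \<Longrightarrow> even k"
    and "j < k"
  shows "(deriv ^^ j) f differentiable at 0"
proof -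
  \<comment> \<open>Vanishing at 0 turns the difference quotient of the j-th derivative into |x|^a V
    / x^(j+1). The second conjunct hands the vanishing on to the next order, as long as that order
    is below \<open>a\<close>.\<close>
  have step: "(deriv ^^ j) f differentiable at 0 \<and> (real (Suc j) < a \<longrightarrow> deriv ((deriv ^^ j) f) 0 = 0)"
    if jk: "j < k" "(deriv ^^ j) f 0 = 0" for j
  proof -
    obtain m V where V: "euler_lim (k - j) m V"
      "\<forall>\<^sub>F x in at 0. (deriv ^^ j) f x = \<bar>x\<bar> powr a * V x / x ^ j"
      using higher_deriv_abs_powr_mult[OF f(1) U less_imp_le[OF jk(1)]] by blast
    have Vm: "(V \<longlongrightarrow> m) (at 0)"
      using V(1) by (rule euler_lim_tendsto)
    have dI: "((deriv ^^ j) f has_real_derivative D) (at 0)"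
      if "((\<lambda>x. \<bar>x\<bar> powr a * V x / x ^ Suc j) \<longlongrightarrow> D) (at 0)" for D
    proof -
      have ev: "\<forall>\<^sub>F x in at 0. \<bar>x\<bar> powr a * V x / x ^ Suc j = ((deriv ^^ j) f (0 + x) - (deriv ^^ j) f 0) / x"
        using V(2) by eventually_elim (simp add: \<open>(deriv ^^ j) f 0 = 0\<close> mult.commute)
      from that show ?thesis
        unfolding DERIV_def tendsto_cong[OF ev] .
    qed
    have "real (Suc j) \<le> real k" using jk(1) by simp
    \<comment> \<open>As j + 1 \<le> k \<le> a, equality with \<open>a\<close> can occur only for j
      + 1 = k, which is where the parity assumption speaks.\<close>
    then consider "real (Suc j) < a" | "real (Suc j) = a" "k = Suc j"
      using k(1) by linarith
    then show ?thesis
    proof cases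
      case 1
      have "((\<lambda>x. \<bar>x\<bar> powr (a - real (Suc j)) * \<bar>V x\<bar>) \<longlongrightarrow> 0 * \<bar>m\<bar>) (at 0)"
        using euler_lim_abs_powr[of "a - real (Suc j)" 0] 1 Vm
        by (intro tendsto_mult tendsto_rabs) auto
      moreover have "\<forall>\<^sub>F x in at 0. \<bar>x\<bar> powr (a - real (Suc j)) * \<bar>V x\<bar> = \<bar>\<bar>x\<bar> powr a * V x / x ^ Suc j\<bar>"
        using eventually_neq_at_within[of 0]
      proof eventually_elim
        case (elim x)
        have "\<bar>x\<bar> powr real (Suc j) = \<bar>x\<bar> ^ Suc j"
          using elim by (intro powr_realpow) simp
        then show ?case
          by (simp add: powr_diff abs_mult power_abs del: of_nat_Suc power_Suc)
      qed
      ultimately have "((\<lambda>x. \<bar>\<bar>x\<bar> powr a * V x / x ^ Suc j\<bar>) \<longlongrightarrow> 0) (at 0)"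
        by (simp add: tendsto_cong)
      from dI[OF tendsto_rabs_zero_cancel[OF this]] show ?thesis
        using DERIV_imp_deriv real_differentiable_def by blast
    next
      case 2
      have ev: "\<forall>\<^sub>F x in at 0. V x = \<bar>x\<bar> powr a * V x / x ^ Suc j"
        using eventually_neq_at_within[of 0]
      proof eventually_elim
        case (elim x)
        have "even (Suc j)" using 2 k(2) by simp
        then have "\<bar>x\<bar> ^ Suc j = x ^ Suc j" by (rule power_even_abs)
        moreover have "\<bar>x\<bar> powr a = \<bar>x\<bar> ^ Suc j"
          unfolding 2(1)[symmetric] using elim by (intro powr_realpow) simp
        ultimately have "\<bar>x\<bar> powr a = x ^ Suc j" by simp
        then show ?case using elim by simp
      qed
      have "((deriv ^^ j) f has_real_derivative m) (at 0)"
        using Vm unfolding tendsto_cong[OF ev] by (rule dI)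
      then show ?thesis
        using 2(1) real_differentiable_def by fastforce
    qed
  qed
  have "(deriv ^^ j) f 0 = 0" if "j < k" for j
    using that
  proof (induction j)
    case (Suc j)
    have "real (Suc j) < a" using Suc.prems k by linarith
    then show ?case using step[of j] Suc by simp
  qed (simp add: f)
  then show ?thesis using step \<open>j < k\<close> by blast
qed

subsection \<open>The transform of the multiquadric\<close>

text \<open>The Matern covariance function without its normalization, extended evenly. At 0 the
  convention \<open>0 powr a = 0\<close> gives the value 0 and not the limit.\<close>

definition matern :: "real \<Rightarrow> real \<Rightarrow> real" where
  "matern \<nu> y = \<bar>y\<bar> powr \<nu> * bessel_K \<nu> \<bar>y\<bar>"

lemma matern_minus [simp]: "matern \<nu> (- y) = matern \<nu> y"
  by (simp add: matern_def)

lemma matern_pos: "y \<noteq> 0 \<Longrightarrow> matern \<nu> y > 0"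
  by (simp add: matern_def bessel_K_pos)

lemma matern_reflect: "y \<noteq> 0 \<Longrightarrow> matern (- \<nu>) y = \<bar>y\<bar> powr (- 2 * \<nu>) * matern \<nu> y"
  by (simp add: matern_def bessel_K_minus flip: powr_add mult.assoc)

lemma matern_rec:
  assumes "y \<noteq> 0"
  shows "matern (\<nu> + 1) y = y\<^sup>2 * matern (\<nu> - 1) y + 2 * \<nu> * matern \<nu> y"
proof -
  have "t powr (\<nu> + 1) = t * t * t powr (\<nu> - 1)" "t powr (\<nu> + 1) / t = t powr \<nu>" if "t > 0" for t :: real
    using that by (simp_all add: powr_add powr_diff)
  from this[of "\<bar>y\<bar>"] have "\<bar>y\<bar> powr (\<nu> + 1) = y\<^sup>2 * \<bar>y\<bar> powr (\<nu> - 1)" "\<bar>y\<bar> powr (\<nu> + 1) / \<bar>y\<bar> = \<bar>y\<bar> powr \<nu>"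
    using assms by (simp_all add: power2_eq_square)
  moreover have "matern (\<nu> + 1) y = \<bar>y\<bar> powr (\<nu> + 1) * bessel_K (\<nu> - 1) \<bar>y\<bar>
      + 2 * \<nu> * (\<bar>y\<bar> powr (\<nu> + 1) / \<bar>y\<bar> * bessel_K \<nu> \<bar>y\<bar>)"
    using bessel_K_rec[of "\<bar>y\<bar>" \<nu>] assms by (simp add: matern_def distrib_left mult_ac)
  ultimately show ?thesis
    by (simp only: matern_def mult.assoc)
qed

text \<open>The power of y is chosen so that the term \<nu> / y from the product rule cancels
  against the recurrence, leaving a single function of lower order.\<close>

lemma matern_has_derivative:
  assumes "y \<noteq> 0"
  shows "(matern \<nu> has_real_derivative - y * matern (\<nu> - 1) y) (at y)"
proof -
  have pos: "(matern \<nu> has_real_derivative - x * matern (\<nu> - 1) x) (at x)" if "x > 0" for x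
  proof -
    have "((\<lambda>x. x powr \<nu> * bessel_K \<nu> x) has_real_derivative
        \<nu> * x powr (\<nu> - 1) * bessel_K \<nu> x
        + - (bessel_K (\<nu> + 1) x + bessel_K (\<nu> - 1) x) / 2 * x powr \<nu>) (at x)"
      using that by (intro DERIV_mult has_real_derivative_powr bessel_K_has_derivative)
    moreover have "\<nu> * x powr (\<nu> - 1) * bessel_K \<nu> x
        + - (bessel_K (\<nu> + 1) x + bessel_K (\<nu> - 1) x) / 2 * x powr \<nu> = - x * matern (\<nu> - 1) x"
      unfolding bessel_K_rec[OF that, of \<nu>]
      using that by (simp add: matern_def powr_diff field_simps)
    ultimately have "((\<lambda>x. x powr \<nu> * bessel_K \<nu> x) has_real_derivative - x * matern (\<nu> - 1) x) (at x)"
      by simp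
    then show ?thesis
      by (rule has_field_derivative_transform_within_open[of _ _ _ "{0<..}"])
         (use that in \<open>auto simp: matern_def\<close>)
  qed
  show ?thesis
  proof (cases "y > 0")
    case False
    then have "(matern \<nu> has_real_derivative - (- y) * matern (\<nu> - 1) (- y)) (at (- y))"
      using assms by (intro pos) simp
    then show ?thesis
      by (simp add: DERIV_mirror)
  qed (rule pos)
qed

lemma matern_le:
  assumes "y \<noteq> 0" "\<nu> \<ge> 1 / 2"
  shows "\<bar>y\<bar> * matern (\<nu> - 1) y \<le> matern \<nu> y"
proof -
  have "\<bar>y\<bar> powr \<nu> * bessel_K (\<nu> - 1) \<bar>y\<bar> \<le> \<bar>y\<bar> powr \<nu> * bessel_K \<nu> \<bar>y\<bar>"
    using assms by (intro mult_left_mono bessel_K_mono) auto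
  then show ?thesis
    using assms by (simp add: matern_def powr_diff)
qed

lemma matern_antimono:
  assumes "0 < \<bar>x\<bar>" "\<bar>x\<bar> \<le> \<bar>y\<bar>"
  shows "matern \<nu> y \<le> matern \<nu> x"
proof -
  have "matern \<nu> \<bar>y\<bar> \<le> matern \<nu> \<bar>x\<bar>"
  proof (rule DERIV_nonpos_imp_nonincreasing[OF assms(2)])
    fix t assume "\<bar>x\<bar> \<le> t"
    then have "t > 0" using assms(1) by linarith
    then show "\<exists>D. (matern \<nu> has_real_derivative D) (at t) \<and> D \<le> 0"
      using matern_has_derivative[of t \<nu>] matern_pos[of t "\<nu> - 1"]
      by (intro exI[of _ "- t * matern (\<nu> - 1) t"]) simp
  qed
  then show ?thesis by (simp add: matern_def)
qed

text \<open>Since \<open>\<bar>matern \<nu>'\<bar> \<le> matern \<nu>\<close>, the function \<open>y \<mapsto> matern \<nu> y * exp y\<close> increases on the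
  positive axis, so the decreasing function \<open>matern \<nu>\<close> is bounded near \<open>0\<close>.\<close>

lemma matern_tendsto:
  assumes "\<nu> \<ge> 1 / 2"
  obtains l where "l > 0" "(matern \<nu> \<longlongrightarrow> l) (at 0)"
proof -
  have bound: "matern \<nu> y \<le> matern \<nu> 1 * exp 1" if "0 < y" "y \<le> 1" for y
  proof -
    have "matern \<nu> y * exp y \<le> matern \<nu> 1 * exp 1"
    proof (rule DERIV_nonneg_imp_nondecreasing[OF that(2)])
      fix t assume "y \<le> t"
      then have t: "t > 0" using that(1) by linarith
      have "((\<lambda>t. matern \<nu> t * exp t) has_real_derivative
          - t * matern (\<nu> - 1) t * exp t + exp t * matern \<nu> t) (at t)"
        using t by (intro DERIV_mult matern_has_derivative DERIV_exp) auto
      moreover have "- t * matern (\<nu> - 1) t * exp t + exp t * matern \<nu> t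
          = exp t * (matern \<nu> t - \<bar>t\<bar> * matern (\<nu> - 1) t)"
        using t by (simp add: algebra_simps)
      moreover have "0 \<le> exp t * (matern \<nu> t - \<bar>t\<bar> * matern (\<nu> - 1) t)"
        using matern_le[of t \<nu>] t assms by (intro mult_nonneg_nonneg) auto
      ultimately show "\<exists>D. ((\<lambda>t. matern \<nu> t * exp t) has_real_derivative D) (at t) \<and> D \<ge> 0"
        by auto
    qed
    moreover have "matern \<nu> y * 1 \<le> matern \<nu> y * exp y"
      using that matern_pos[of y \<nu>] by (intro mult_left_mono) auto
    ultimately show ?thesis by simp
  qed
  define l where "l = (SUP y\<in>{0<..1}. matern \<nu> y)"
  have bdd: "bdd_above (matern \<nu> ` {0<..1})"
    using bound by (intro bdd_aboveI2[where M = "matern \<nu> 1 * exp 1"]) auto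
  have ge: "matern \<nu> y \<le> l" if "0 < y" "y \<le> 1" for y
    unfolding l_def using that by (intro cSUP_upper bdd) auto
  have ev1: "\<forall>\<^sub>F y in at_right 0. y \<in> {0<..<1::real}"
    by (rule eventually_at_right_real) simp
  have R: "(matern \<nu> \<longlongrightarrow> l) (at_right 0)"
  proof (rule increasing_tendsto)
    show "\<forall>\<^sub>F y in at_right 0. matern \<nu> y \<le> l"
      using ev1 by eventually_elim (simp add: ge)
    fix x assume "x < l"
    then obtain z where z: "0 < z" "z \<le> 1" "x < matern \<nu> z"
      unfolding l_def by (subst (asm) less_cSUP_iff[OF _ bdd]) auto
    have "\<forall>\<^sub>F y in at_right 0. y \<in> {0<..<z}"
      by (rule eventually_at_right_real) (rule z)
    then show "\<forall>\<^sub>F y in at_right 0. x < matern \<nu> y"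
      by eventually_elim (use z matern_antimono[of _ z \<nu>] in \<open>force intro: less_le_trans\<close>)
  qed
  moreover have "(matern \<nu> \<longlongrightarrow> l) (at_left 0)"
    using R unfolding filterlim_at_left_to_right by simp
  ultimately have "(matern \<nu> \<longlongrightarrow> l) (at 0)"
    by (intro filterlim_split_at)
  moreover have "l > 0"
    using ge[of 1] matern_pos[of 1 \<nu>] by simp
  ultimately show ?thesis using that by blast
qed

text \<open>With y = c x, the pair \<open>E\<close>, \<open>V\<close> of y^\<nu> K and y^2 times its
  lower neighbour is closed under the Euler operator: \<open>E\<close> goes to - V, and
  \<open>V\<close> to 2 \<nu> V - y^2 E by the recurrence. Hence one induction treats both. That
  \<open>V\<close> tends to 0 follows from \<open>matern_le\<close>.\<close>

lemma euler_lim_matern: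
  assumes "c > 0" "\<nu> \<ge> 1 / 2"
  obtains l where "l > 0" "\<And>n. euler_lim n l (\<lambda>x. matern \<nu> (c * x))"
proof -
  obtain l where l: "l > 0" "(matern \<nu> \<longlongrightarrow> l) (at 0)"
    using matern_tendsto[OF assms(2)] .
  define E where "E x = matern \<nu> (c * x)" for x
  define V where "V x = (c * x)\<^sup>2 * matern (\<nu> - 1) (c * x)" for x
  have "filterlim (\<lambda>x. c * x) (at 0) (at 0)"
    unfolding filterlim_at using assms
    by (auto intro!: tendsto_eq_intros simp: eventually_at_filter)
  from filterlim_compose[OF l(2) this] have Elim: "(E \<longlongrightarrow> l) (at 0)"
    unfolding E_def .
  have Vlim: "(V \<longlongrightarrow> 0) (at 0)"
  proof (rule Lim_null_comparison)
    show "((\<lambda>x. \<bar>c * x\<bar> * E x) \<longlongrightarrow> 0) (at 0)"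
      by (rule tendsto_eq_intros Elim | simp)+
    show "\<forall>\<^sub>F x in at 0. norm (V x) \<le> \<bar>c * x\<bar> * E x"
      using eventually_neq_at_within[of 0]
    proof eventually_elim
      case (elim x)
      then have cx: "c * x \<noteq> 0" using assms by simp
      have "norm (V x) = \<bar>c * x\<bar> * (\<bar>c * x\<bar> * matern (\<nu> - 1) (c * x))"
        using matern_pos[OF cx, of "\<nu> - 1"]
        by (simp add: V_def abs_mult power2_eq_square)
      also have "\<dots> \<le> \<bar>c * x\<bar> * E x"
        unfolding E_def by (intro mult_left_mono matern_le cx assms) auto
      finally show ?case .
    qed
  qed
  have "euler_lim n l E \<and> euler_lim n 0 V" for n
  proof (induction n)
    case 0
    then show ?case using Elim Vlim by simp
  next
    case (Suc n)
    then have IH: "euler_lim n l E" "euler_lim n 0 V" by auto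
    have chain: "((\<lambda>x. matern \<mu> (c * x)) has_real_derivative - (c * x) * matern (\<mu> - 1) (c * x) * c) (at x)"
      if "x \<noteq> 0" for x \<mu>
      using that assms(1) DERIV_cmult_Id[of c]
      by (intro DERIV_chain2[where f = "matern \<mu>"] matern_has_derivative) auto
    have "euler_lim (Suc n) l E"
    proof (rule euler_lim_SucI[OF Elim])
      show "\<forall>\<^sub>F x in at 0. (E has_real_derivative - (c * x) * matern (\<nu> - 1) (c * x) * c) (at x)"
        unfolding E_def using eventually_neq_at_within[of 0] by eventually_elim (rule chain)
      show "euler_lim n 0 (\<lambda>x. x * (- (c * x) * matern (\<nu> - 1) (c * x) * c))"
        using euler_lim_cmult[OF IH(2), of "- 1"] by (simp add: V_def power2_eq_square mult_ac)
    qed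
    moreover have "euler_lim (Suc n) 0 V"
    proof (rule euler_lim_SucI[OF Vlim])
      show "\<forall>\<^sub>F x in at 0. (V has_real_derivative
          (2 * (c * x) * c) * matern (\<nu> - 1) (c * x)
          + (- (c * x) * matern (\<nu> - 1 - 1) (c * x) * c) * (c * x)\<^sup>2) (at x)"
        unfolding V_def using eventually_neq_at_within[of 0]
      proof eventually_elim
        case (elim x)
        show ?case
          by (rule DERIV_mult[OF _ chain[OF elim]]) (auto intro!: derivative_eq_intros)
      qed
      have "euler_lim n (2 * \<nu> * 0 + - 1 * (c * 0 * (c * 0) * l))
          (\<lambda>x. 2 * \<nu> * V x + - 1 * (c * x * (c * x) * E x))"
        by (intro euler_lim_add euler_lim_cmult euler_lim_mult euler_lim_ident IH)
      then have "euler_lim n 0 (\<lambda>x. 2 * \<nu> * V x + - 1 * (c * x * (c * x) * E x))"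
        by simp
      then show "euler_lim n 0 (\<lambda>x. x * ((2 * (c * x) * c) * matern (\<nu> - 1) (c * x)
          + (- (c * x) * matern (\<nu> - 1 - 1) (c * x) * c) * (c * x)\<^sup>2))"
      proof (rule euler_lim_cong)
        show "\<forall>\<^sub>F x in at 0. 2 * \<nu> * V x + - 1 * (c * x * (c * x) * E x)
            = x * ((2 * (c * x) * c) * matern (\<nu> - 1) (c * x)
          + (- (c * x) * matern (\<nu> - 1 - 1) (c * x) * c) * (c * x)\<^sup>2)"
          using eventually_neq_at_within[of 0]
        proof eventually_elim
          case (elim x)
          then have "E x = (c * x)\<^sup>2 * matern (\<nu> - 1 - 1) (c * x) + 2 * (\<nu> - 1) * matern (\<nu> - 1) (c * x)"
            using matern_rec[of "c * x" "\<nu> - 1"] assms by (simp add: E_def)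
          then show ?case
            unfolding V_def by (simp only:) (simp add: power2_eq_square algebra_simps)
        qed
      qed
    qed
    ultimately show ?case by blast
  qed
  then show ?thesis using that l unfolding E_def by blast
qed

text \<open>The function G of the overview, written with the negative order so that differentiation
  raises the index without powers of c: the derivative is - x times the function for \<nu> + 1. Its
  ratio to the transform depends on \<alpha> only.\<close>

definition mq :: "real \<Rightarrow> real \<Rightarrow> real \<Rightarrow> real" where
  "mq \<nu> c x = c powr (2 * \<nu>) * matern (- \<nu>) (c * x)"

lemma mq_eq:
  assumes "c > 0" "x \<noteq> 0"
  shows "mq \<nu> c x = \<bar>x\<bar> powr (- 2 * \<nu>) * matern \<nu> (c * x)"
proof -
  have "c powr (2 * \<nu>) * c powr (- 2 * \<nu>) = 1"
    using assms by (simp flip: powr_add)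
  moreover have "matern (- \<nu>) (c * x) = c powr (- 2 * \<nu>) * \<bar>x\<bar> powr (- 2 * \<nu>) * matern \<nu> (c * x)"
    using assms by (simp add: matern_reflect powr_mult abs_mult)
  ultimately show ?thesis
    by (simp add: mq_def mult.assoc[symmetric])
qed

lemma multiquadric_hat_eq_mq:
  assumes "c > 0" "x \<noteq> 0"
  shows "multiquadric_hat \<alpha> c x = 2 powr (1 + \<alpha>) / Gamma (- \<alpha>) * mq (\<alpha> + 1 / 2) c x"
proof -
  define \<nu> where "\<nu> = \<alpha> + 1 / 2"
  have "c powr (2 * \<nu>) * (c * \<bar>x\<bar>) powr - \<nu> = (c / \<bar>x\<bar>) powr \<nu>"
  proof -
    have "c powr (2 * \<nu>) = c powr \<nu> * c powr \<nu>"
      by (simp flip: powr_add)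
    then show ?thesis
      using assms by (simp add: powr_mult powr_divide powr_minus_divide)
  qed
  then have "mq \<nu> c x = (c / \<bar>x\<bar>) powr \<nu> * bessel_K \<nu> (c * \<bar>x\<bar>)"
    using assms by (simp add: mq_def matern_def bessel_K_minus abs_mult flip: mult.assoc)
  then show ?thesis
    unfolding multiquadric_hat_def \<nu>_def[symmetric] by simp
qed

lemma mq_pos: "c > 0 \<Longrightarrow> x \<noteq> 0 \<Longrightarrow> mq \<nu> c x > 0"
  by (simp add: mq_def matern_pos)

lemma mq_has_derivative:
  assumes "c > 0" "x \<noteq> 0"
  shows "(mq \<nu> c has_real_derivative - x * mq (\<nu> + 1) c x) (at x)"
proof -
  have "((\<lambda>x. matern (- \<nu>) (c * x)) has_real_derivative - (c * x) * matern (- \<nu> - 1) (c * x) * c) (at x)"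
    using assms DERIV_cmult_Id[of c]
    by (intro DERIV_chain2[where f = "matern (- \<nu>)"] matern_has_derivative) auto
  from DERIV_cmult[OF this, of "c powr (2 * \<nu>)"]
  have "(mq \<nu> c has_real_derivative
      c powr (2 * \<nu>) * (- (c * x) * matern (- \<nu> - 1) (c * x) * c)) (at x)"
    unfolding mq_def .
  moreover have "c powr (2 * (\<nu> + 1)) = c powr (2 * \<nu>) * c * c"
    using assms by (simp add: distrib_left powr_add power2_eq_square mult.assoc)
  ultimately show ?thesis
    by (simp add: mq_def mult_ac)
qed

text \<open>The left side is the absolute value of the derivative of \<open>mq \<nu> c\<close>, so
  this bounds the logarithmic derivative and is the origin of the weight c + 1/|x|. It is the
  recurrence at order - \<nu>, with the lower order estimated by monotonicity in the order.\<close>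

lemma mq_succ_le:
  assumes "c > 0" "x \<noteq> 0" "\<nu> \<ge> 1 / 2"
  shows "\<bar>x\<bar> * mq (\<nu> + 1) c x \<le> (c + 2 * \<nu> / \<bar>x\<bar>) * mq \<nu> c x"
proof -
  define y where "y = c * x"
  have y: "y \<noteq> 0" using assms by (simp add: y_def)
  have "matern (1 - \<nu>) y = \<bar>y\<bar> powr (1 - \<nu>) * bessel_K (\<nu> - 1) \<bar>y\<bar>"
    using bessel_K_minus[of "\<nu> - 1" "\<bar>y\<bar>"] by (simp add: matern_def)
  also have "\<dots> \<le> \<bar>y\<bar> powr (1 - \<nu>) * bessel_K \<nu> \<bar>y\<bar>"
    using assms y by (intro mult_left_mono bessel_K_mono) auto
  also have "\<dots> = \<bar>y\<bar> * matern (- \<nu>) y"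
    using y by (simp add: matern_def bessel_K_minus powr_diff powr_minus_divide)
  finally have "y\<^sup>2 * matern (- \<nu> - 1) y \<le> (\<bar>y\<bar> + 2 * \<nu>) * matern (- \<nu>) y"
    using matern_rec[OF y, of "- \<nu>"] by (simp add: algebra_simps)
  then have "c powr (2 * \<nu>) / \<bar>x\<bar> * (y\<^sup>2 * matern (- \<nu> - 1) y)
      \<le> c powr (2 * \<nu>) / \<bar>x\<bar> * ((\<bar>y\<bar> + 2 * \<nu>) * matern (- \<nu>) y)"
    by (intro mult_left_mono) auto
  moreover have "c powr (2 * \<nu>) / \<bar>x\<bar> * (y\<^sup>2 * matern (- \<nu> - 1) y) = \<bar>x\<bar> * mq (\<nu> + 1) c x"
  proof -
    have "c powr (2 * (\<nu> + 1)) = c powr (2 * \<nu>) * c * c"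
      using assms by (simp add: distrib_left powr_add power2_eq_square mult.assoc)
    moreover have "y\<^sup>2 / \<bar>x\<bar> = c * c * \<bar>x\<bar>"
      using assms by (simp add: y_def power2_eq_square field_simps)
    moreover have "c powr (2 * \<nu>) / \<bar>x\<bar> * (y\<^sup>2 * matern (- \<nu> - 1) y)
        = c powr (2 * \<nu>) * (y\<^sup>2 / \<bar>x\<bar>) * matern (- \<nu> - 1) y"
      by simp
    ultimately show ?thesis
      by (simp add: mq_def y_def[symmetric] mult_ac)
  qed
  moreover have "c powr (2 * \<nu>) / \<bar>x\<bar> * ((\<bar>y\<bar> + 2 * \<nu>) * matern (- \<nu>) y) = (c + 2 * \<nu> / \<bar>x\<bar>) * mq \<nu> c x"
    using assms by (simp add: mq_def y_def abs_mult field_simps)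
  ultimately show ?thesis by simp
qed

text \<open>The function is its own majorant. The induction varies \<nu>, because the derivative
  involves the index \<nu> + 1; \<open>mq_succ_le\<close> then brings the majorant back to index
  \<nu> at the cost of one weight.\<close>

lemma deriv_bound_mq:
  assumes "\<nu> \<ge> 1 / 2"
  shows "deriv_bound n {(c, x). c \<ge> 1 \<and> x \<noteq> 0} (\<lambda>c x. c + 1 / \<bar>x\<bar>) (mq \<nu>) (mq \<nu>)"
  using assms
proof (induction n arbitrary: \<nu>)
  let ?S = "{(c, x). c \<ge> 1 \<and> x \<noteq> 0} :: (real \<times> real) set"
  have dom: "dominated ?S (mq \<nu>) (mq \<nu>)" for \<nu>
    using mq_pos by (intro dominatedI[where C = 1]) (auto simp: less_imp_le)
  {
    case 0
    then show ?case using dom by simp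
  next
    case (Suc n)
    have "dominated ?S (\<lambda>c x. \<bar>x\<bar>) (\<lambda>c x. x)"
      by (intro dominatedI[where C = 1]) auto
    \<comment> \<open>The factor x fits the calculus since its derivative 1 is at most (c + 1/|x|)
      |x| = c |x| + 1.\<close>
    moreover have "deriv_bound m ?S (\<lambda>c x. c + 1 / \<bar>x\<bar>) (\<lambda>c x. (c + 1 / \<bar>x\<bar>) * \<bar>x\<bar>) (\<lambda>c x. 1)" for m
      by (intro deriv_bound_const dominatedI[where C = 1]) (auto simp: field_simps)
    ultimately have id: "deriv_bound n ?S (\<lambda>c x. c + 1 / \<bar>x\<bar>) (\<lambda>c x. \<bar>x\<bar>) (\<lambda>c x. x)"
      by (cases n) (auto intro!: exI[of _ "\<lambda>c x. 1"])
    have "deriv_bound n ?S (\<lambda>c x. c + 1 / \<bar>x\<bar>) (\<lambda>c x. \<bar>x\<bar> * mq (\<nu> + 1) c x)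
        (\<lambda>c x. - 1 * (x * mq (\<nu> + 1) c x))"
      using Suc.prems by (intro deriv_bound_cmult deriv_bound_mult id Suc.IH) simp
    then have "deriv_bound n ?S (\<lambda>c x. c + 1 / \<bar>x\<bar>) (\<lambda>c x. (c + 1 / \<bar>x\<bar>) * mq \<nu> c x)
        (\<lambda>c x. - 1 * (x * mq (\<nu> + 1) c x))"
    proof (rule deriv_bound_mono[where a = 1 and b = "1 + 2 * \<nu>"])
      fix c x :: real assume "(c, x) \<in> ?S"
      then have cx: "c \<ge> 1" "x \<noteq> 0" by auto
      then have pos: "mq (\<nu> + 1) c x > 0" "mq \<nu> c x > 0" by (auto intro: mq_pos)
      have "c + 2 * \<nu> / \<bar>x\<bar> \<le> (1 + 2 * \<nu>) * (c + 1 / \<bar>x\<bar>)"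
        using cx Suc.prems by (simp add: distrib_right distrib_left add_divide_distrib add_increasing)
      then have "(c + 2 * \<nu> / \<bar>x\<bar>) * mq \<nu> c x \<le> (1 + 2 * \<nu>) * (c + 1 / \<bar>x\<bar>) * mq \<nu> c x"
        using pos by (intro mult_right_mono) auto
      then show "0 \<le> \<bar>x\<bar> * mq (\<nu> + 1) c x
          \<and> \<bar>x\<bar> * mq (\<nu> + 1) c x \<le> (1 + 2 * \<nu>) * ((c + 1 / \<bar>x\<bar>) * mq \<nu> c x)"
        using order_trans[OF mq_succ_le[of c x \<nu>]] cx Suc.prems pos by (simp add: mult.assoc)
    qed (auto simp: field_simps)
    then show ?case
      using mq_has_derivative
      by (intro deriv_bound_SucI[OF dom]) (auto simp: mult.assoc)
  }
qed

subsection \<open>Periodization\<close>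

lemma int_decode_Suc_neq_0: "int_decode (Suc n) \<noteq> 0"
proof
  assume "int_decode (Suc n) = 0"
  then have "int_encode 0 = Suc n" using int_decode_inverse[of "Suc n"] by simp
  then show False by (simp add: int_encode_def sum_encode_def)
qed

text \<open>A nonnegative i has code 2 i and a negative one 2 |i| - 1. The factor 2 matches the one
  in \<open>abs_shift_ge\<close>, so the shifted terms compare directly with powers of n +
  1.\<close>

lemma Suc_le_int_decode_Suc: "real (Suc n) \<le> 2 * \<bar>real_of_int (int_decode (Suc n))\<bar>"
proof -
  define i where "i = int_decode (Suc n)"
  have "int_encode i = Suc n" by (simp add: i_def)
  then have "int (Suc n) \<le> 2 * \<bar>i\<bar>"
    by (auto simp: int_encode_def sum_encode_def split: if_splits)
  then have "real_of_int (int (Suc n)) \<le> real_of_int (2 * \<bar>i\<bar>)"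
    by (simp only: of_int_le_iff)
  then show ?thesis by (simp add: i_def)
qed

definition mq_shift :: "real \<Rightarrow> real \<times> int \<Rightarrow> real \<Rightarrow> real" where
  "mq_shift \<nu> q x = mq \<nu> (fst q) (x + 2 * pi * of_int (snd q))"

definition mq_tail :: "real \<Rightarrow> real \<Rightarrow> real \<Rightarrow> real" where
  "mq_tail \<nu> c x = (\<Sum>n. mq_shift \<nu> (c, int_decode (Suc n)) x)"

definition mq_per :: "real \<Rightarrow> real \<Rightarrow> real \<Rightarrow> real" where
  "mq_per \<nu> c x = mq \<nu> c x + mq_tail \<nu> c x"

text \<open>The radius 4 gives an open interval around the closed period [-\<pi>, \<pi>] that still
  avoids the other lattice points: 2 \<pi> > 6, and 6 |j| - 4 \<ge> 2 |j| for j nonzero.\<close>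

lemma abs_shift_ge:
  fixes x :: real and j :: int
  assumes "j \<noteq> 0" "\<bar>x\<bar> < 4"
  shows "2 * \<bar>real_of_int j\<bar> \<le> \<bar>x + 2 * pi * of_int j\<bar>" "2 \<le> \<bar>x + 2 * pi * of_int j\<bar>"
proof -
  have j: "1 \<le> \<bar>real_of_int j\<bar>" using assms(1) by linarith
  have "6 * \<bar>real_of_int j\<bar> \<le> \<bar>2 * pi * of_int j\<bar>"
    using pi_gt3 by (simp add: abs_mult mult_right_mono)
  then show "2 * \<bar>real_of_int j\<bar> \<le> \<bar>x + 2 * pi * of_int j\<bar>"
    using assms(2) j by linarith
  then show "2 \<le> \<bar>x + 2 * pi * of_int j\<bar>" using j by linarith
qed

lemma shift_neq_0:
  fixes x :: real and j :: int
  assumes "x \<noteq> 0" "\<bar>x\<bar> < 4" shows "x + 2 * pi * of_int j \<noteq> 0"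
  using assms abs_shift_ge(2)[of j x] by (cases "j = 0") auto

lemma mq_shift_pos: "c > 0 \<Longrightarrow> x + 2 * pi * of_int j \<noteq> 0 \<Longrightarrow> mq_shift \<nu> (c, j) x > 0"
  by (simp add: mq_shift_def mq_pos)

lemma mq_shift_0 [simp]: "mq_shift \<nu> (c, 0) x = mq \<nu> c x"
  by (simp add: mq_shift_def)

text \<open>The right side does not involve x; summed over j it is the majorant for termwise
  differentiation.\<close>

lemma mq_shift_le:
  assumes "c > 0" "j \<noteq> 0" "\<bar>x\<bar> < 4" "\<nu> > 0"
  shows "mq_shift \<nu> (c, j) x \<le> (2 * \<bar>of_int j\<bar>) powr (- 2 * \<nu>) * matern \<nu> (c * 2)"
proof -
  define y where "y = x + 2 * pi * of_int j"
  have y: "2 * \<bar>real_of_int j\<bar> \<le> \<bar>y\<bar>" "2 \<le> \<bar>y\<bar>" "y \<noteq> 0"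
    using abs_shift_ge[OF assms(2,3)] by (auto simp: y_def)
  have "mq_shift \<nu> (c, j) x = \<bar>y\<bar> powr (- 2 * \<nu>) * matern \<nu> (c * y)"
    using mq_eq[OF assms(1) y(3)] by (simp add: mq_shift_def y_def)
  also have "\<dots> \<le> (2 * \<bar>of_int j\<bar>) powr (- 2 * \<nu>) * matern \<nu> (c * 2)"
    using y assms matern_pos[of "c * y" \<nu>]
    by (intro mult_mono powr_mono2' matern_antimono) (auto simp: abs_mult)
  finally show ?thesis .
qed

text \<open>For |x| \<le> \<pi> no shifted point is closer to 0 than x, so monotonicity of
  \<open>matern\<close> compares the two Bessel factors whatever c is. What remains is a ratio of
  powers, which supplies the order of vanishing |x|^(2 \<nu>).\<close>

lemma mq_shift_le_mult_mq:
  assumes "c > 0" "j \<noteq> 0" "x \<noteq> 0" "\<bar>x\<bar> \<le> pi" "\<nu> > 0"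
  shows "mq_shift \<nu> (c, j) x \<le> mq \<nu> c x * (\<bar>x\<bar> powr (2 * \<nu>) * (2 * \<bar>of_int j\<bar>) powr (- 2 * \<nu>))"
proof -
  define y where "y = x + 2 * pi * of_int j"
  have x4: "\<bar>x\<bar> < 4" using assms pi_less_4 by linarith
  have y: "2 * \<bar>real_of_int j\<bar> \<le> \<bar>y\<bar>" "y \<noteq> 0"
    using abs_shift_ge[OF assms(2) x4] by (auto simp: y_def)
  have "2 * pi * 1 \<le> 2 * pi * \<bar>real_of_int j\<bar>"
    using assms(2) by (intro mult_left_mono) auto
  then have "2 * pi \<le> \<bar>2 * pi * real_of_int j\<bar>"
    by (simp add: abs_mult)
  then have xy: "\<bar>x\<bar> \<le> \<bar>y\<bar>" using assms(4) unfolding y_def by linarith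
  have "mq_shift \<nu> (c, j) x = \<bar>y\<bar> powr (- 2 * \<nu>) * matern \<nu> (c * y)"
    using mq_eq[OF assms(1) y(2)] by (simp add: mq_shift_def y_def)
  also have "\<dots> \<le> (2 * \<bar>of_int j\<bar>) powr (- 2 * \<nu>) * matern \<nu> (c * x)"
    using y xy assms matern_pos[of "c * y" \<nu>]
    by (intro mult_mono powr_mono2' matern_antimono) (auto simp: abs_mult)
  also have "matern \<nu> (c * x) = \<bar>x\<bar> powr (2 * \<nu>) * mq \<nu> c x"
    using assms by (simp add: mq_eq powr_minus)
  finally show ?thesis by (simp add: mult_ac)
qed

lemma summable_Suc_powr: "\<nu> > 1 / 2 \<Longrightarrow> summable (\<lambda>n. real (Suc n) powr (- 2 * \<nu>))"
  by (subst summable_Suc_iff) (simp add: summable_real_powr_iff)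

lemma int_decode_powr_le:
  "\<nu> > 0 \<Longrightarrow> (2 * \<bar>real_of_int (int_decode (Suc n))\<bar>) powr (- 2 * \<nu>) \<le> real (Suc n) powr (- 2 * \<nu>)"
  using Suc_le_int_decode_Suc[of n] by (intro powr_mono2') auto

lemma mq_shift_int_decode_le:
  assumes "c > 0" "\<bar>x\<bar> < 4" "\<nu> > 1 / 2"
  shows "mq_shift \<nu> (c, int_decode (Suc n)) x \<le> real (Suc n) powr (- 2 * \<nu>) * matern \<nu> (c * 2)"
proof -
  have "mq_shift \<nu> (c, int_decode (Suc n)) x
      \<le> (2 * \<bar>of_int (int_decode (Suc n))\<bar>) powr (- 2 * \<nu>) * matern \<nu> (c * 2)"
    using assms by (intro mq_shift_le int_decode_Suc_neq_0) auto
  also have "\<dots> \<le> real (Suc n) powr (- 2 * \<nu>) * matern \<nu> (c * 2)"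
    using assms matern_pos[of "c * 2" \<nu>] by (intro mult_right_mono int_decode_powr_le) auto
  finally show ?thesis .
qed

lemma mq_shift_int_decode_pos:
  assumes "c > 0" "\<bar>x\<bar> < 4"
  shows "mq_shift \<nu> (c, int_decode (Suc n)) x > 0"
  using abs_shift_ge(2)[OF int_decode_Suc_neq_0 assms(2), of n] assms(1)
  by (intro mq_shift_pos) auto

lemma summable_mq_shift:
  assumes "c > 0" "\<bar>x\<bar> < 4" "\<nu> > 1 / 2"
  shows "summable (\<lambda>n. mq_shift \<nu> (c, int_decode (Suc n)) x)"
proof (rule summable_comparison_test'[where N = 0])
  show "summable (\<lambda>n. real (Suc n) powr (- 2 * \<nu>) * matern \<nu> (c * 2))"
    by (intro summable_mult2 summable_Suc_powr assms)
  show "norm (mq_shift \<nu> (c, int_decode (Suc n)) x) \<le> real (Suc n) powr (- 2 * \<nu>) * matern \<nu> (c * 2)" for n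
    using mq_shift_int_decode_le[OF assms, of n] mq_shift_int_decode_pos[OF assms(1,2), of \<nu> n] by simp
qed

lemma mq_tail_pos:
  assumes "c > 0" "\<bar>x\<bar> < 4" "\<nu> > 1 / 2"
  shows "mq_tail \<nu> c x > 0"
  unfolding mq_tail_def using assms
  by (intro suminf_pos summable_mq_shift mq_shift_int_decode_pos)

lemma mq_per_pos:
  assumes "c > 0" "x \<noteq> 0" "\<bar>x\<bar> < 4" "\<nu> > 1 / 2"
  shows "mq_per \<nu> c x > 0"
  using mq_tail_pos[of c x \<nu>] mq_pos[of c x \<nu>] assms by (simp add: mq_per_def)

lemma mq_tail_le_mult_mq:
  assumes "c > 0" "x \<noteq> 0" "\<bar>x\<bar> \<le> pi" "\<nu> > 1 / 2"
  shows "mq_tail \<nu> c x \<le> mq \<nu> c x * (\<bar>x\<bar> powr (2 * \<nu>) * (\<Sum>n. real (Suc n) powr (- 2 * \<nu>)))"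
proof -
  have x4: "\<bar>x\<bar> < 4" using assms pi_less_4 by linarith
  have "mq_tail \<nu> c x \<le> (\<Sum>n. mq \<nu> c x * \<bar>x\<bar> powr (2 * \<nu>) * real (Suc n) powr (- 2 * \<nu>))"
    unfolding mq_tail_def
  proof (rule suminf_le)
    fix n
    have "mq_shift \<nu> (c, int_decode (Suc n)) x
        \<le> mq \<nu> c x * (\<bar>x\<bar> powr (2 * \<nu>) * (2 * \<bar>of_int (int_decode (Suc n))\<bar>) powr (- 2 * \<nu>))"
      using assms by (intro mq_shift_le_mult_mq int_decode_Suc_neq_0) auto
    also have "\<dots> \<le> mq \<nu> c x * (\<bar>x\<bar> powr (2 * \<nu>) * real (Suc n) powr (- 2 * \<nu>))"
      using assms mq_pos[of c x \<nu>] by (intro mult_left_mono int_decode_powr_le) auto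
    finally show "mq_shift \<nu> (c, int_decode (Suc n)) x
        \<le> mq \<nu> c x * \<bar>x\<bar> powr (2 * \<nu>) * real (Suc n) powr (- 2 * \<nu>)"
      by (simp add: mult.assoc)
  qed (intro summable_mq_shift summable_mult summable_Suc_powr assms x4)+
  also have "\<dots> = mq \<nu> c x * (\<bar>x\<bar> powr (2 * \<nu>) * (\<Sum>n. real (Suc n) powr (- 2 * \<nu>)))"
    unfolding mult.assoc[symmetric] using summable_Suc_powr[OF assms(4)] by (rule suminf_mult)
  finally show ?thesis .
qed

text \<open>Shifted points have modulus at least 2, so 1/|x + 2 \<pi> j| \<le> 1 \<le> c and the
  weight reduces to c, free of j and x as the series lemma demands.\<close>

lemma deriv_bound_mq_shift:
  assumes "\<nu> > 1 / 2"
  shows "deriv_bound n {(q, x). fst q \<ge> 1 \<and> snd q \<noteq> 0 \<and> \<bar>x\<bar> < 4} (\<lambda>q x. fst q) (mq_shift \<nu>) (mq_shift \<nu>)"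
proof -
  have "deriv_bound n {(q, x). fst q \<ge> 1 \<and> snd q \<noteq> 0 \<and> \<bar>x\<bar> < 4}
      (\<lambda>q x. fst q + 1 / \<bar>x + 2 * pi * of_int (snd q)\<bar>) (mq_shift \<nu>) (mq_shift \<nu>)"
    unfolding mq_shift_def
  proof (rule deriv_bound_subst[OF deriv_bound_mq])
    show "(fst q, x + 2 * pi * of_int (snd q)) \<in> {(c, x). c \<ge> 1 \<and> x \<noteq> 0}"
      if "(q, x) \<in> {(q, x). fst q \<ge> 1 \<and> snd q \<noteq> 0 \<and> \<bar>x\<bar> < 4}" for q :: "real \<times> int" and x :: real
      using that abs_shift_ge(2)[of "snd q" x] by auto
  qed (use assms in simp)
  then show ?thesis
  proof (rule deriv_bound_mono[where a = 2 and b = 1])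
    fix q :: "real \<times> int" and x :: real
    assume "(q, x) \<in> {(q, x). fst q \<ge> 1 \<and> snd q \<noteq> 0 \<and> \<bar>x\<bar> < 4}"
    then have q: "fst q \<ge> 1" and s: "2 \<le> \<bar>x + 2 * pi * of_int (snd q)\<bar>"
      using abs_shift_ge(2)[of "snd q" x] by auto
    then have "1 / \<bar>x + 2 * pi * of_int (snd q)\<bar> \<le> 1"
      by (simp add: divide_le_eq_1)
    then show "0 \<le> fst q + 1 / \<bar>x + 2 * pi * of_int (snd q)\<bar>
        \<and> fst q + 1 / \<bar>x + 2 * pi * of_int (snd q)\<bar> \<le> 2 * fst q"
      using q by simp
    show "0 \<le> mq_shift \<nu> q x \<and> mq_shift \<nu> q x \<le> 1 * mq_shift \<nu> q x"
      using mq_shift_pos[of "fst q" x "snd q" \<nu>] q s by force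
  qed
qed

lemma deriv_bound_mq_tail:
  assumes "\<nu> > 1 / 2"
  shows "deriv_bound n {(c, x). c \<ge> 1 \<and> \<bar>x\<bar> < 4} (\<lambda>c x. c) (mq_tail \<nu>) (mq_tail \<nu>)"
proof -
  define f where "f q x = mq_shift \<nu> (fst q, int_decode (Suc (snd q))) x" for q :: "real \<times> nat" and x
  have "deriv_bound n {(c, x). c \<ge> 1 \<and> \<bar>x\<bar> < 4} (\<lambda>c x. c) (\<lambda>c x. \<Sum>n. f (c, n) x) (\<lambda>c x. \<Sum>n. f (c, n) x)"
  proof (rule deriv_bound_suminf[where M = "\<lambda>c n. real (Suc n) powr (- 2 * \<nu>) * matern \<nu> (c * 2)"])
    show "deriv_bound n {(q, x). (fst q, x) \<in> {(c, x). c \<ge> 1 \<and> \<bar>x\<bar> < 4}} (\<lambda>q x. fst q) f f"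
      using deriv_bound_subst[OF deriv_bound_mq_shift[OF assms],
          of "{(q, x). (fst q, x) \<in> {(c, x). c \<ge> 1 \<and> \<bar>x\<bar> < 4}}"
            "\<lambda>q. (fst q, int_decode (Suc (snd q)))" "\<lambda>q. 0" n]
      by (simp add: f_def[abs_def] int_decode_Suc_neq_0)
    show "convex {x::real. (c, x) \<in> {(c, x). c \<ge> 1 \<and> \<bar>x\<bar> < 4}}" for c :: real
    proof -
      have "{x::real. (c, x) \<in> {(c, x). c \<ge> 1 \<and> \<bar>x\<bar> < 4}} = (if c \<ge> 1 then {-4<..<4} else {})"
        by auto
      then show ?thesis by simp
    qed
    show "open {x::real. (c, x) \<in> {(c, x). c \<ge> 1 \<and> \<bar>x\<bar> < 4}}" for c :: real
    proof -
      have "{x::real. (c, x) \<in> {(c, x). c \<ge> 1 \<and> \<bar>x\<bar> < 4}} = (if c \<ge> 1 then {-4<..<4} else {})"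
        by auto
      then show ?thesis by simp
    qed
    fix c x :: real and j
    assume "(c, x) \<in> {(c, x). c \<ge> 1 \<and> \<bar>x\<bar> < 4}"
    then have c: "c \<ge> 1" "\<bar>x\<bar> < 4" by auto
    show "0 \<le> c" using c by simp
    show "0 \<le> f (c, j) x"
      using mq_shift_int_decode_pos[of c x \<nu> j] c by (simp add: f_def)
    show "f (c, j) x \<le> real (Suc j) powr (- 2 * \<nu>) * matern \<nu> (c * 2)"
      using mq_shift_int_decode_le[of c x \<nu> j] c assms by (simp add: f_def)
    show "summable (\<lambda>n. real (Suc n) powr (- 2 * \<nu>) * matern \<nu> (c * 2))"
      by (intro summable_mult2 summable_Suc_powr assms)
  qed
  then show ?thesis
    by (simp add: f_def mq_tail_def[abs_def])
qed

text \<open>Both the singular term and the tail are positive, so each is dominated by their sum; the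
  periodization is thus its own majorant and its own lower bound. The second parameter component is
  left arbitrary so that m can take its place.\<close>

lemma deriv_bound_inverse_mq_per:
  assumes "\<nu> > 1 / 2"
  shows "deriv_bound n {(q, x). fst q \<ge> 1 \<and> x \<noteq> 0 \<and> \<bar>x\<bar> < 4} (\<lambda>q x. fst q / \<bar>x\<bar>)
    (\<lambda>q x. inverse (mq_per \<nu> (fst q) x)) (\<lambda>q x. inverse (mq_per \<nu> (fst q) x))"
proof (rule deriv_bound_inverse[where c = 1])
  let ?S = "{(q, x). fst q \<ge> 1 \<and> x \<noteq> 0 \<and> \<bar>x\<bar> < 4} :: ((real \<times> 'a) \<times> real) set"
  \<comment> \<open>On 0 < |x| < 4 one has c \<le> 4 c/|x|, and 1/|x| \<le> c/|x| by c \<ge> 1. This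
    merges the two weights into c/|x|.\<close>
  have w: "0 \<le> c + 1 / \<bar>x\<bar> \<and> c + 1 / \<bar>x\<bar> \<le> 5 * (c / \<bar>x\<bar>)" "c \<le> 5 * (c / \<bar>x\<bar>)"
    if "c \<ge> 1" "x \<noteq> 0" "\<bar>x\<bar> < 4" for c x :: real
  proof -
    have "c * \<bar>x\<bar> \<le> c * 4" using that by (intro mult_left_mono) auto
    then have "c \<le> c * 4 / \<bar>x\<bar>" using that by (simp add: pos_le_divide_eq)
    moreover have "0 \<le> 1 / \<bar>x\<bar>" "1 / \<bar>x\<bar> \<le> c / \<bar>x\<bar>"
      using that by (auto intro: divide_right_mono)
    ultimately show "0 \<le> c + 1 / \<bar>x\<bar> \<and> c + 1 / \<bar>x\<bar> \<le> 5 * (c / \<bar>x\<bar>)" "c \<le> 5 * (c / \<bar>x\<bar>)"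
      using that by auto
  qed
  have 1: "deriv_bound n ?S (\<lambda>q x. fst q / \<bar>x\<bar>) (\<lambda>q x. mq_per \<nu> (fst q) x) (\<lambda>q x. mq \<nu> (fst q) x)"
  proof (rule deriv_bound_mono[where a = 5 and b = 1])
    show "deriv_bound n ?S (\<lambda>q x. fst q + 1 / \<bar>x\<bar>) (\<lambda>q x. mq \<nu> (fst q) x) (\<lambda>q x. mq \<nu> (fst q) x)"
      using deriv_bound_subst[OF deriv_bound_mq, of \<nu> ?S fst "\<lambda>q. 0" n] assms by auto
    fix q :: "real \<times> 'a" and x
    assume "(q, x) \<in> ?S"
    then have q: "fst q \<ge> 1" "x \<noteq> 0" "\<bar>x\<bar> < 4" by auto
    show "0 \<le> fst q + 1 / \<bar>x\<bar> \<and> fst q + 1 / \<bar>x\<bar> \<le> 5 * (fst q / \<bar>x\<bar>)"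
      by (rule w(1)[OF q])
    show "0 \<le> mq \<nu> (fst q) x \<and> mq \<nu> (fst q) x \<le> 1 * mq_per \<nu> (fst q) x"
      using mq_pos[of "fst q" x \<nu>] mq_tail_pos[of "fst q" x \<nu>] q assms by (simp add: mq_per_def)
  qed
  have 2: "deriv_bound n ?S (\<lambda>q x. fst q / \<bar>x\<bar>) (\<lambda>q x. mq_per \<nu> (fst q) x) (\<lambda>q x. mq_tail \<nu> (fst q) x)"
  proof (rule deriv_bound_mono[where a = 5 and b = 1])
    show "deriv_bound n ?S (\<lambda>q x. fst q) (\<lambda>q x. mq_tail \<nu> (fst q) x) (\<lambda>q x. mq_tail \<nu> (fst q) x)"
      using deriv_bound_subst[OF deriv_bound_mq_tail, of \<nu> ?S fst "\<lambda>q. 0" n] assms by auto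
    fix q :: "real \<times> 'a" and x
    assume "(q, x) \<in> ?S"
    then have q: "fst q \<ge> 1" "x \<noteq> 0" "\<bar>x\<bar> < 4" by auto
    show "0 \<le> fst q \<and> fst q \<le> 5 * (fst q / \<bar>x\<bar>)"
      using w(2)[OF q] q by simp
    show "0 \<le> mq_tail \<nu> (fst q) x \<and> mq_tail \<nu> (fst q) x \<le> 1 * mq_per \<nu> (fst q) x"
      using mq_pos[of "fst q" x \<nu>] mq_tail_pos[of "fst q" x \<nu>] q assms by (simp add: mq_per_def)
  qed
  show "deriv_bound n ?S (\<lambda>q x. fst q / \<bar>x\<bar>) (\<lambda>q. mq_per \<nu> (fst q)) (\<lambda>q. mq_per \<nu> (fst q))"
    using deriv_bound_add[OF 1 2] by (simp add: mq_per_def[abs_def])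
  fix q :: "real \<times> 'a" and x
  assume "(q, x) \<in> ?S"
  then have q: "fst q \<ge> 1" "x \<noteq> 0" "\<bar>x\<bar> < 4" by auto
  show "0 \<le> fst q / \<bar>x\<bar>" using q by simp
  show "0 < mq_per \<nu> (fst q) x \<and> mq_per \<nu> (fst q) x \<le> 1 * \<bar>mq_per \<nu> (fst q) x\<bar>"
    using mq_per_pos[of "fst q" x \<nu>] q assms by simp
qed

lemma deriv_bound_mult_inverse_mq_per:
  assumes "\<nu> > 1 / 2" "deriv_bound n S (\<lambda>q x. fst q) h h"
    and S: "S \<subseteq> {(q, x). fst q \<ge> 1 \<and> x \<noteq> 0 \<and> \<bar>x\<bar> < 4}"
    and h: "\<And>q x. (q, x) \<in> S \<Longrightarrow> 0 \<le> h q x"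
  shows "deriv_bound n S (\<lambda>q x. fst q / \<bar>x\<bar>) (\<lambda>q x. h q x * inverse (mq_per \<nu> (fst q) x))
    (\<lambda>q x. h q x * inverse (mq_per \<nu> (fst q) x))"
proof (rule deriv_bound_mult)
  show "deriv_bound n S (\<lambda>q x. fst q / \<bar>x\<bar>) h h"
    using assms(2)
  proof (rule deriv_bound_mono[where a = 4 and b = 1])
    fix q x assume "(q, x) \<in> S"
    then have q: "fst q \<ge> 1" "x \<noteq> 0" "\<bar>x\<bar> < 4" using S by auto
    then have "fst q * \<bar>x\<bar> \<le> fst q * 4" by (intro mult_left_mono) auto
    then show "0 \<le> fst q \<and> fst q \<le> 4 * (fst q / \<bar>x\<bar>)"
      using q by (simp add: field_simps)
  qed (use h in simp)
  show "deriv_bound n S (\<lambda>q x. fst q / \<bar>x\<bar>)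
    (\<lambda>q x. inverse (mq_per \<nu> (fst q) x)) (\<lambda>q x. inverse (mq_per \<nu> (fst q) x))"
    using deriv_bound_subst[OF deriv_bound_inverse_mq_per[OF assms(1)], of S "\<lambda>q. q" "\<lambda>q. 0" n] S
    by auto
qed

text \<open>The quotient near the lattice point \<open>2 \<pi> m\<close>, in terms of the offset \<open>x\<close> from it and up to its
  value \<open>0\<close> or \<open>1\<close> at that point.\<close>

definition cardinal_dev :: "real \<Rightarrow> real \<Rightarrow> int \<Rightarrow> real \<Rightarrow> real" where
  "cardinal_dev \<nu> c m x =
    (if m = 0 then - mq_tail \<nu> c x else mq_shift \<nu> (c, m) x) * inverse (mq_per \<nu> c x)"

text \<open>The periodization is bounded below by its singular term, relative to which the
  numerators were estimated; no c survives.\<close>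

lemma abs_cardinal_dev_le:
  assumes "c > 0" "x \<noteq> 0" "\<bar>x\<bar> \<le> pi" "\<nu> > 1 / 2"
  shows "\<bar>cardinal_dev \<nu> c m x\<bar> \<le> \<bar>x\<bar> powr (2 * \<nu>) *
    (if m = 0 then \<Sum>n. real (Suc n) powr (- 2 * \<nu>) else (2 * \<bar>of_int m\<bar>) powr (- 2 * \<nu>))"
    (is "_ \<le> ?r")
proof -
  have x4: "\<bar>x\<bar> < 4" using assms pi_less_4 by linarith
  define N where "N = (if m = 0 then mq_tail \<nu> c x else mq_shift \<nu> (c, m) x)"
  have N: "0 \<le> N" "N \<le> mq \<nu> c x * ?r"
    using mq_tail_pos[of c x \<nu>] mq_shift_pos[of c x m \<nu>] shift_neq_0[of x m] x4 assms
      mq_tail_le_mult_mq[of c x \<nu>] mq_shift_le_mult_mq[of c m x \<nu>]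
    by (auto simp: N_def)
  have P: "0 < mq \<nu> c x" "mq \<nu> c x \<le> mq_per \<nu> c x"
    using mq_pos[of c x \<nu>] mq_tail_pos[of c x \<nu>] x4 assms by (auto simp: mq_per_def)
  have "\<bar>cardinal_dev \<nu> c m x\<bar> = N / mq_per \<nu> c x"
    using N(1) P unfolding cardinal_dev_def N_def by (simp add: abs_mult divide_inverse split: if_splits)
  also have "\<dots> \<le> N / mq \<nu> c x"
    using N P by (intro divide_left_mono) auto
  also have "\<dots> \<le> ?r"
    using N(2) P(1) by (simp add: pos_divide_le_eq mult.commute)
  finally show ?thesis .
qed

lemma open_punctured: "open {x::real. c \<ge> (1::real) \<and> P \<and> x \<noteq> 0 \<and> \<bar>x\<bar> < 4}"
proof -
  have "{x::real. c \<ge> (1::real) \<and> P \<and> x \<noteq> 0 \<and> \<bar>x\<bar> < 4} = (if c \<ge> 1 \<and> P then {-4<..<4} - {0} else {})"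
    by auto
  then show ?thesis by (simp add: open_delete)
qed

text \<open>The absolute value of the function is its own majorant, so any bound on its size is
  inherited by the derivatives. The two cases have numerators from different families, the tail and
  a single shifted term.\<close>

lemma deriv_bound_cardinal_dev:
  assumes "\<nu> > 1 / 2"
  shows "deriv_bound n {(q, x). fst q \<ge> 1 \<and> snd q = 0 \<and> x \<noteq> 0 \<and> \<bar>x\<bar> < 4} (\<lambda>q x. fst q / \<bar>x\<bar>)
      (\<lambda>q x. \<bar>cardinal_dev \<nu> (fst q) (snd q) x\<bar>) (\<lambda>q. cardinal_dev \<nu> (fst q) (snd q))" (is ?A)
    and "deriv_bound n {(q, x). fst q \<ge> 1 \<and> snd q \<noteq> 0 \<and> x \<noteq> 0 \<and> \<bar>x\<bar> < 4} (\<lambda>q x. fst q / \<bar>x\<bar>)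
      (\<lambda>q x. \<bar>cardinal_dev \<nu> (fst q) (snd q) x\<bar>) (\<lambda>q. cardinal_dev \<nu> (fst q) (snd q))" (is ?B)
proof -
  let ?S = "{(q, x). fst q \<ge> 1 \<and> snd q = 0 \<and> x \<noteq> 0 \<and> \<bar>x\<bar> < 4} :: ((real \<times> int) \<times> real) set"
  let ?T = "{(q, x). fst q \<ge> 1 \<and> snd q \<noteq> 0 \<and> x \<noteq> 0 \<and> \<bar>x\<bar> < 4} :: ((real \<times> int) \<times> real) set"
  have S: "deriv_bound n ?S (\<lambda>q x. fst q / \<bar>x\<bar>)
      (\<lambda>q x. mq_tail \<nu> (fst q) x * inverse (mq_per \<nu> (fst q) x))
      (\<lambda>q x. mq_tail \<nu> (fst q) x * inverse (mq_per \<nu> (fst q) x))"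
    using deriv_bound_subst[OF deriv_bound_mq_tail, of \<nu> ?S fst "\<lambda>q. 0" n] assms
    by (intro deriv_bound_mult_inverse_mq_per) (auto intro!: less_imp_le[OF mq_tail_pos])
  have "deriv_bound n ?S (\<lambda>q x. fst q / \<bar>x\<bar>) (\<lambda>q x. \<bar>cardinal_dev \<nu> (fst q) (snd q) x\<bar>)
      (\<lambda>q x. - 1 * (mq_tail \<nu> (fst q) x * inverse (mq_per \<nu> (fst q) x)))"
    using deriv_bound_cmult[OF S, of "- 1"]
  proof (rule deriv_bound_mono[where a = 1 and b = 1])
    fix q :: "real \<times> int" and x assume "(q, x) \<in> ?S"
    then show "0 \<le> mq_tail \<nu> (fst q) x * inverse (mq_per \<nu> (fst q) x)
        \<and> mq_tail \<nu> (fst q) x * inverse (mq_per \<nu> (fst q) x) \<le> 1 * \<bar>cardinal_dev \<nu> (fst q) (snd q) x\<bar>"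
      using mq_tail_pos[of "fst q" x \<nu>] mq_per_pos[of "fst q" x \<nu>] assms
      by (auto simp: cardinal_dev_def abs_mult)
  qed auto
  then show ?A
    by (rule deriv_bound_cong) (auto simp: cardinal_dev_def open_punctured)
  have T: "deriv_bound n ?T (\<lambda>q x. fst q / \<bar>x\<bar>)
      (\<lambda>q x. mq_shift \<nu> q x * inverse (mq_per \<nu> (fst q) x))
      (\<lambda>q x. mq_shift \<nu> q x * inverse (mq_per \<nu> (fst q) x))"
  proof (rule deriv_bound_mult_inverse_mq_per[OF assms])
    show "deriv_bound n ?T (\<lambda>q x. fst q) (mq_shift \<nu>) (mq_shift \<nu>)"
      using deriv_bound_subst[OF deriv_bound_mq_shift, of \<nu> ?T "\<lambda>q. q" "\<lambda>q. 0" n] assms by auto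
    show "0 \<le> mq_shift \<nu> q x" if "(q, x) \<in> ?T" for q :: "real \<times> int" and x
      using that mq_shift_pos[of "fst q" x "snd q" \<nu>] shift_neq_0[of x "snd q"] by auto
  qed auto
  have "deriv_bound n ?T (\<lambda>q x. fst q / \<bar>x\<bar>) (\<lambda>q x. \<bar>cardinal_dev \<nu> (fst q) (snd q) x\<bar>)
      (\<lambda>q x. mq_shift \<nu> q x * inverse (mq_per \<nu> (fst q) x))"
    using T
  proof (rule deriv_bound_mono[where a = 1 and b = 1])
    fix q :: "real \<times> int" and x assume "(q, x) \<in> ?T"
    then show "0 \<le> mq_shift \<nu> q x * inverse (mq_per \<nu> (fst q) x)
        \<and> mq_shift \<nu> q x * inverse (mq_per \<nu> (fst q) x) \<le> 1 * \<bar>cardinal_dev \<nu> (fst q) (snd q) x\<bar>"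
      using mq_shift_pos[of "fst q" x "snd q" \<nu>] shift_neq_0[of x "snd q"]
        mq_per_pos[of "fst q" x \<nu>] assms
      by (auto simp: cardinal_dev_def abs_mult)
  qed auto
  then show ?B
    by (rule deriv_bound_cong) (auto simp: cardinal_dev_def open_punctured)
qed

lemma higher_deriv_cardinal_dev_le:
  assumes "\<nu> > 1 / 2" "real k \<le> 2 * \<nu>"
  obtains B where "B \<ge> 0" and "\<And>c m x. c \<ge> 1 \<Longrightarrow> x \<noteq> 0 \<Longrightarrow> \<bar>x\<bar> \<le> pi \<Longrightarrow>
    \<bar>(deriv ^^ k) (cardinal_dev \<nu> c m) x\<bar> \<le> B * c ^ k *
    (if m = 0 then \<Sum>n. real (Suc n) powr (- 2 * \<nu>) else (2 * \<bar>of_int m\<bar>) powr (- 2 * \<nu>))"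
proof -
  have "dominated {(q, x). fst q \<ge> 1 \<and> snd q = 0 \<and> x \<noteq> 0 \<and> \<bar>x\<bar> < 4}
      (\<lambda>q x. (fst q / \<bar>x\<bar>) ^ k * \<bar>cardinal_dev \<nu> (fst q) (snd q) x\<bar>)
      (\<lambda>q. (deriv ^^ k) (cardinal_dev \<nu> (fst q) (snd q)))"
    by (rule deriv_bound_higher_deriv[OF deriv_bound_cardinal_dev(1)[OF assms(1)]])
       (simp add: open_punctured)
  then obtain C where C: "\<And>q x. (q, x) \<in> {(q, x). fst q \<ge> 1 \<and> snd q = 0 \<and> x \<noteq> 0 \<and> \<bar>x\<bar> < 4} \<Longrightarrow>
      \<bar>(deriv ^^ k) (cardinal_dev \<nu> (fst q) (snd q)) x\<bar>
      \<le> C * ((fst q / \<bar>x\<bar>) ^ k * \<bar>cardinal_dev \<nu> (fst q) (snd q) x\<bar>)"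
    by (rule dominatedE) blast
  have "dominated {(q, x). fst q \<ge> 1 \<and> snd q \<noteq> 0 \<and> x \<noteq> 0 \<and> \<bar>x\<bar> < 4}
      (\<lambda>q x. (fst q / \<bar>x\<bar>) ^ k * \<bar>cardinal_dev \<nu> (fst q) (snd q) x\<bar>)
      (\<lambda>q. (deriv ^^ k) (cardinal_dev \<nu> (fst q) (snd q)))"
    by (rule deriv_bound_higher_deriv[OF deriv_bound_cardinal_dev(2)[OF assms(1)]])
       (simp add: open_punctured)
  then obtain D where D: "\<And>q x. (q, x) \<in> {(q, x). fst q \<ge> 1 \<and> snd q \<noteq> 0 \<and> x \<noteq> 0 \<and> \<bar>x\<bar> < 4} \<Longrightarrow>
      \<bar>(deriv ^^ k) (cardinal_dev \<nu> (fst q) (snd q)) x\<bar>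
      \<le> D * ((fst q / \<bar>x\<bar>) ^ k * \<bar>cardinal_dev \<nu> (fst q) (snd q) x\<bar>)"
    by (rule dominatedE) blast
  \<comment> \<open>One constant for both cases; the absolute values make it nonnegative, which
    \<open>dominated\<close> does not promise of \<open>C\<close> and \<open>D\<close>.\<close>
  define E where "E = max \<bar>C\<bar> \<bar>D\<bar>"
  show ?thesis
  proof (rule that[of "E * pi powr (2 * \<nu> - real k)"])
    show "0 \<le> E * pi powr (2 * \<nu> - real k)" by (simp add: E_def)
    fix c x :: real and m :: int
    assume c: "c \<ge> 1" "x \<noteq> 0" "\<bar>x\<bar> \<le> pi"
    define Q where "Q = (if m = 0 then \<Sum>n. real (Suc n) powr (- 2 * \<nu>) else (2 * \<bar>of_int m\<bar>) powr (- 2 * \<nu>))"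
    have x4: "\<bar>x\<bar> < 4" using c pi_less_4 by linarith
    have dev: "\<bar>cardinal_dev \<nu> c m x\<bar> \<le> \<bar>x\<bar> powr (2 * \<nu>) * Q"
      unfolding Q_def using c assms(1) by (intro abs_cardinal_dev_le) auto
    have nn: "0 \<le> (c / \<bar>x\<bar>) ^ k * \<bar>cardinal_dev \<nu> c m x\<bar>" using c by simp
    have Q: "0 \<le> Q"
      unfolding Q_def using summable_Suc_powr[OF assms(1)] by (auto intro: suminf_nonneg)
    have "C \<le> E" "D \<le> E" by (auto simp: E_def)
    moreover obtain F where "F = C \<or> F = D" "\<bar>(deriv ^^ k) (cardinal_dev \<nu> c m) x\<bar>
        \<le> F * ((c / \<bar>x\<bar>) ^ k * \<bar>cardinal_dev \<nu> c m x\<bar>)"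
      using C[of "(c, m)" x] D[of "(c, m)" x] c x4 by (cases "m = 0") auto
    ultimately have "F \<le> E" "\<bar>(deriv ^^ k) (cardinal_dev \<nu> c m) x\<bar>
        \<le> F * ((c / \<bar>x\<bar>) ^ k * \<bar>cardinal_dev \<nu> c m x\<bar>)"
      by auto
    then have "\<bar>(deriv ^^ k) (cardinal_dev \<nu> c m) x\<bar> \<le> E * ((c / \<bar>x\<bar>) ^ k * \<bar>cardinal_dev \<nu> c m x\<bar>)"
      using mult_right_mono[OF _ nn, of F E] by linarith
    also have "\<dots> \<le> E * ((c / \<bar>x\<bar>) ^ k * (\<bar>x\<bar> powr (2 * \<nu>) * Q))"
      using c by (intro mult_left_mono dev) (auto simp: E_def)
    also have "\<dots> = E * \<bar>x\<bar> powr (2 * \<nu> - real k) * c ^ k * Q"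
      using c by (simp add: powr_diff powr_realpow power_divide)
    \<comment> \<open>Here k \<le> 2 \<nu> enters: the remaining power of |x| has a nonnegative
      exponent and is bounded on the period.\<close>
    also have "\<dots> \<le> E * pi powr (2 * \<nu> - real k) * c ^ k * Q"
      using c assms(2) Q by (intro mult_right_mono mult_left_mono powr_mono2) (auto simp: E_def)
    finally show "\<bar>(deriv ^^ k) (cardinal_dev \<nu> c m) x\<bar> \<le> E * pi powr (2 * \<nu> - real k) * c ^ k * Q" .
  qed
qed

lemma higher_deriv_cardinal_dev_differentiable:
  assumes "\<nu> > 1 / 2" "c \<ge> 1" "x \<noteq> 0" "\<bar>x\<bar> < 4"
  shows "(deriv ^^ n) (cardinal_dev \<nu> c m) differentiable at x"
proof (cases "m = 0")
  case True
  then show ?thesis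
    using deriv_bound_differentiable[OF deriv_bound_cardinal_dev(1)[OF assms(1)], of "(c, m)" x n] assms
    by (simp add: open_punctured)
next
  case False
  then show ?thesis
    using deriv_bound_differentiable[OF deriv_bound_cardinal_dev(2)[OF assms(1)], of "(c, m)" x n] assms
    by (simp add: open_punctured)
qed

lemma eventually_at_0_less_4: "\<forall>\<^sub>F x::real in at 0. x \<noteq> 0 \<and> \<bar>x\<bar> < 4"
proof -
  have "\<forall>\<^sub>F x::real in at 0. x \<in> {-4<..<4} - {0}"
    by (intro eventually_at_in_open) auto
  then show ?thesis by eventually_elim auto
qed

text \<open>Multiplying numerator and denominator by |x|^(2 \<nu>) removes the singularity of the
  periodization: the new denominator \<open>D\<close> tends to the positive limit of
  \<open>matern\<close>, so its reciprocal stays in the Euler class. Here c is fixed and nothing is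
  uniform.\<close>

lemma cardinal_dev_euler_lim:
  assumes "\<nu> > 1 / 2" "c \<ge> 1"
  obtains l U where "euler_lim n l U" "\<forall>\<^sub>F x in at 0. cardinal_dev \<nu> c m x = \<bar>x\<bar> powr (2 * \<nu>) * U x"
proof -
  obtain l where l: "l > 0" "\<And>n. euler_lim n l (\<lambda>x. matern \<nu> (c * x))"
    using euler_lim_matern[of c \<nu>] assms by auto
  define D where "D x = matern \<nu> (c * x) + \<bar>x\<bar> powr (2 * \<nu>) * mq_tail \<nu> c x" for x
  have op: "open {x::real. c \<ge> 1 \<and> P \<and> \<bar>x\<bar> < 4}" for P and c :: real
  proof -
    have "{x::real. c \<ge> 1 \<and> P \<and> \<bar>x\<bar> < 4} = (if c \<ge> 1 \<and> P then {-4<..<4} else {})" by auto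
    then show ?thesis by simp
  qed
  have tail: "euler_lim n (mq_tail \<nu> c 0) (mq_tail \<nu> c)" for n
    using deriv_bound_imp_euler_lim[OF deriv_bound_mq_tail[OF assms(1)], of c n] assms op[of c True] by simp
  have shift: "euler_lim n (mq_shift \<nu> (c, m) 0) (mq_shift \<nu> (c, m))" if "m \<noteq> 0" for n
    using deriv_bound_imp_euler_lim[OF deriv_bound_mq_shift[OF assms(1)], of "(c, m)" n] assms op[of c True] that
    by simp
  define N where "N x = (if m = 0 then - 1 * mq_tail \<nu> c x else mq_shift \<nu> (c, m) x)" for x
  obtain r where N: "euler_lim n r N"
  proof (cases "m = 0")
    case True
    then have "N = (\<lambda>x. - 1 * mq_tail \<nu> c x)" by (simp add: N_def fun_eq_iff)
    with euler_lim_cmult[OF tail, of n "- 1"] show ?thesis by (intro that) (simp only:)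
  next
    case False
    then have "N = mq_shift \<nu> (c, m)" by (simp add: N_def fun_eq_iff)
    with shift[OF False, of n] show ?thesis by (intro that) (simp only:)
  qed
  have "euler_lim n (l + 0 * mq_tail \<nu> c 0) D"
    unfolding D_def using assms(1)
    by (intro euler_lim_add euler_lim_mult euler_lim_abs_powr l tail) simp
  then have "euler_lim n (inverse (l + 0 * mq_tail \<nu> c 0)) (\<lambda>x. inverse (D x))"
    using l(1) by (intro euler_lim_inverse) auto
  from euler_lim_mult[OF N this] show ?thesis
  proof (rule that)
    show "\<forall>\<^sub>F x in at 0. cardinal_dev \<nu> c m x = \<bar>x\<bar> powr (2 * \<nu>) * (N x * inverse (D x))"
      using eventually_at_0_less_4
    proof eventually_elim
      case (elim x)
      have "D x = \<bar>x\<bar> powr (2 * \<nu>) * mq_per \<nu> c x"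
        using elim assms by (simp add: D_def mq_per_def mq_eq distrib_left powr_minus)
      moreover have "\<bar>x\<bar> powr (2 * \<nu>) \<noteq> 0" using elim by simp
      ultimately show ?case
        by (simp add: cardinal_dev_def N_def)
    qed
  qed
qed

subsection \<open>The cardinal function\<close>

text \<open>No differentiability is assumed: \<open>deriv\<close> selects from the set of admissible
  values, and this set is the same on both sides.\<close>

lemma higher_deriv_shift: "(deriv ^^ n) (\<lambda>x. f (x + a)) = (\<lambda>x::real. (deriv ^^ n) f (x + a))"
proof (induction n)
  case (Suc n)
  have "deriv (\<lambda>x. g (x + a)) = (\<lambda>x. deriv g (x + a))" for g :: "real \<Rightarrow> real"
    unfolding deriv_def by (simp add: DERIV_shift[symmetric] fun_eq_iff)
  with Suc show ?case by simp
qed simp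

lemma higher_deriv_add_const:
  "(deriv ^^ n) (\<lambda>x::real. f x + a) = (\<lambda>x. (deriv ^^ n) f x + (if n = 0 then a else 0))"
proof (cases n)
  case (Suc m)
  have "deriv (\<lambda>x::real. f x + a) = deriv f"
  proof
    fix x
    have "((\<lambda>x. f x + a) has_real_derivative D) (at x) \<longleftrightarrow> (f has_real_derivative D) (at x)" for D
      using DERIV_add[OF _ DERIV_const[of a], of f D x UNIV]
        DERIV_add[OF _ DERIV_const[of "- a"], of "\<lambda>x. f x + a" D x UNIV] by auto
    then show "deriv (\<lambda>x. f x + a) x = deriv f x" by (simp add: deriv_def)
  qed
  then show ?thesis by (simp add: Suc funpow_Suc_right del: funpow.simps)
qed simp

lemma differentiable_cong_ev:
  fixes f :: "real \<Rightarrow> real"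
  assumes "\<forall>\<^sub>F y in nhds x. f y = g y" "f differentiable at x"
  shows "g differentiable at x"
  using assms DERIV_cong_ev[OF refl assms(1) refl] unfolding real_differentiable_def by blast

text \<open>Positive terms make the enumerated series unconditionally summable, which gives the
  unordered sum over the integers.\<close>

lemma mq_per_has_sum:
  assumes "c > 0" "x \<noteq> 0" "\<bar>x\<bar> < 4" "\<nu> > 1 / 2"
  shows "((\<lambda>j. mq_shift \<nu> (c, j) x) has_sum mq_per \<nu> c x) UNIV"
proof -
  have 0: "int_decode 0 = 0"
    by (simp add: int_decode_def sum_decode_def)
  have "(\<lambda>n. mq_shift \<nu> (c, int_decode (Suc n)) x) sums mq_tail \<nu> c x"
    unfolding mq_tail_def using assms by (intro summable_sums summable_mq_shift)
  then have "(\<lambda>n. mq_shift \<nu> (c, int_decode n) x) sums (mq_tail \<nu> c x + mq_shift \<nu> (c, int_decode 0) x)"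
    using sums_Suc[of "\<lambda>n. mq_shift \<nu> (c, int_decode n) x"] by blast
  then have "(\<lambda>n. mq_shift \<nu> (c, int_decode n) x) sums mq_per \<nu> c x"
    by (simp add: 0 mq_per_def add.commute)
  then have "((\<lambda>n. mq_shift \<nu> (c, int_decode n) x) has_sum mq_per \<nu> c x) UNIV"
  proof (rule sums_nonneg_imp_has_sum)
    show "0 \<le> mq_shift \<nu> (c, int_decode n) x" for n
      using mq_shift_pos[OF assms(1) shift_neq_0[OF assms(2,3)]] by (simp add: less_imp_le)
  qed
  then show ?thesis
    using has_sum_reindex_bij_betw[OF bij_int_decode, of "\<lambda>j. mq_shift \<nu> (c, j) x"] by simp
qed

lemma cardinal_quotient_eq:
  assumes \<alpha>: "\<alpha> > 0" "\<alpha> \<notin> \<nat>" and c: "c \<ge> 1" and x: "x \<noteq> 0" "\<bar>x\<bar> < 4"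
  shows "cardinal_quotient \<alpha> c (x + 2 * pi * of_int m)
    = cardinal_dev (\<alpha> + 1 / 2) c m x + of_bool (m = 0)"
proof -
  define \<nu> where "\<nu> = \<alpha> + 1 / 2"
  have \<nu>: "\<nu> > 1 / 2" using \<alpha> by (simp add: \<nu>_def)
  define \<kappa> where "\<kappa> = 2 powr (1 + \<alpha>) / Gamma (- \<alpha>)"
  \<comment> \<open>As \<alpha> is not a natural number, - \<alpha> avoids the poles of
    \<open>Gamma\<close>, where its value is 0 by convention; so the common factor can be
    cancelled.\<close>
  have \<kappa>: "\<kappa> \<noteq> 0"
    using Gamma_nonzero[of "- \<alpha>"] \<alpha>(2) by (simp add: \<kappa>_def uminus_in_nonpos_Ints_iff)
  have hat: "multiquadric_hat \<alpha> c (x + 2 * pi * of_int j) = \<kappa> * mq_shift \<nu> (c, j) x" for j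
    using multiquadric_hat_eq_mq[of c "x + 2 * pi * of_int j" \<alpha>] c shift_neq_0[OF x]
    by (simp add: mq_shift_def \<kappa>_def \<nu>_def)
  have P: "mq_per \<nu> c x > 0"
    using c x \<nu> by (intro mq_per_pos) auto
  \<comment> \<open>The periodization does not change under translation by 2 \<pi> m; only the
    numerator remembers m.\<close>
  have "(\<Sum>\<^sub>\<infinity>j. multiquadric_hat \<alpha> c (x + 2 * pi * of_int m + 2 * pi * of_int j))
      = (\<Sum>\<^sub>\<infinity>j. \<kappa> * mq_shift \<nu> (c, j + m) x)"
    by (intro infsum_cong) (simp add: hat[symmetric] algebra_simps)
  also have "\<dots> = (\<Sum>\<^sub>\<infinity>j. \<kappa> * mq_shift \<nu> (c, j) x)"
  proof (rule infsum_reindex_bij_betw)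
    show "bij (\<lambda>j. j + m)" by (rule bij_plus_right)
  qed
  also have "\<dots> = \<kappa> * mq_per \<nu> c x"
    using mq_per_has_sum[of c x \<nu>] c x \<nu> by (intro infsumI has_sum_cmult_right) auto
  finally have "cardinal_quotient \<alpha> c (x + 2 * pi * of_int m) = mq_shift \<nu> (c, m) x / mq_per \<nu> c x"
    using \<kappa> by (simp add: cardinal_quotient_def hat)
  also have "\<dots> = cardinal_dev \<nu> c m x + of_bool (m = 0)"
    using P by (simp add: cardinal_dev_def mq_per_def field_simps)
  finally show ?thesis unfolding \<nu>_def .
qed

text \<open>The case distinction corrects an accidental value: \<open>mq\<close> is 0 at 0, so
  \<open>cardinal_dev\<close> there is, for m = 0, equal to -1, while its limit is 0.\<close>

lemma cardinal_hat_eq: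
  assumes \<alpha>: "\<alpha> > 0" "\<alpha> \<notin> \<nat>" and c: "c \<ge> 1" and x: "\<bar>x\<bar> < 4"
  shows "cardinal_hat \<alpha> c (x + 2 * pi * of_int m)
    = (if x = 0 then 0 else cardinal_dev (\<alpha> + 1 / 2) c m x) + of_bool (m = 0)"
proof (cases "x = 0")
  case False
  have "\<nexists>m'::int. x + 2 * pi * of_int m = 2 * pi * of_int m'"
  proof
    assume "\<exists>m'::int. x + 2 * pi * of_int m = 2 * pi * of_int m'"
    then obtain m' :: int where "x + 2 * pi * of_int m = 2 * pi * of_int m'" ..
    then have "x + 2 * pi * of_int (m - m') = 0" by (simp add: algebra_simps)
    then show False using shift_neq_0[OF False x] by blast
  qed
  then show ?thesis
    using cardinal_quotient_eq[OF \<alpha> c False x] False by (simp add: cardinal_hat_def)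
next
  case True
  obtain l U where U: "euler_lim 0 l U"
    "\<forall>\<^sub>F x in at 0. cardinal_dev (\<alpha> + 1 / 2) c m x = \<bar>x\<bar> powr (2 * (\<alpha> + 1 / 2)) * U x"
    using cardinal_dev_euler_lim[of "\<alpha> + 1 / 2" c 0 m] \<alpha> c by auto
  have "((\<lambda>x. \<bar>x\<bar> powr (2 * (\<alpha> + 1 / 2)) * U x + of_bool (m = 0)) \<longlongrightarrow> 0 * l + of_bool (m = 0)) (at 0)"
    using euler_lim_tendsto[OF U(1)] euler_lim_abs_powr[of "2 * (\<alpha> + 1 / 2)" 0] \<alpha>
    by (intro tendsto_intros) auto
  moreover have "\<forall>\<^sub>F x in at 0. \<bar>x\<bar> powr (2 * (\<alpha> + 1 / 2)) * U x + of_bool (m = 0)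
      = cardinal_quotient \<alpha> c (x + 2 * pi * of_int m)"
    using U(2) eventually_at_0_less_4
    by eventually_elim (simp add: cardinal_quotient_eq[OF \<alpha> c])
  ultimately have "((\<lambda>x. cardinal_quotient \<alpha> c (x + 2 * pi * of_int m)) \<longlongrightarrow> of_bool (m = 0)) (at 0)"
    by (simp add: tendsto_cong)
  then have "(cardinal_quotient \<alpha> c \<longlongrightarrow> of_bool (m = 0)) (at (2 * pi * of_int m))"
    unfolding filterlim_at_to_0[of _ _ "2 * pi * of_int m"] .
  then have "Lim (at (2 * pi * of_int m)) (cardinal_quotient \<alpha> c) = of_bool (m = 0)"
    by (intro tendsto_Lim) auto
  then show ?thesis
    using True by (auto simp: cardinal_hat_def)
qed

lemma higher_deriv_cardinal_hat_eq:
  assumes \<alpha>: "\<alpha> > 0" "\<alpha> \<notin> \<nat>" and c: "c \<ge> 1" and x: "\<bar>x\<bar> < 4"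
  shows "(deriv ^^ n) (cardinal_hat \<alpha> c) (x + 2 * pi * of_int m)
    = (deriv ^^ n) (\<lambda>x. if x = 0 then 0 else cardinal_dev (\<alpha> + 1 / 2) c m x) x
      + (if n = 0 then of_bool (m = 0) else 0)"
proof -
  have "\<forall>\<^sub>F y in nhds x. y \<in> {-4<..<4}"
    using x by (intro eventually_nhds_in_open) auto
  then have "\<forall>\<^sub>F y in nhds x. cardinal_hat \<alpha> c (y + 2 * pi * of_int m)
      = (if y = 0 then 0 else cardinal_dev (\<alpha> + 1 / 2) c m y) + of_bool (m = 0)"
    by eventually_elim (rule cardinal_hat_eq[OF \<alpha> c], auto)
  from higher_deriv_cong_ev[OF this refl, of n] show ?thesis
    unfolding higher_deriv_shift higher_deriv_add_const .
qed

lemma eventually_higher_deriv_cardinal_dev: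
  assumes "x \<noteq> (0::real)"
  shows "\<forall>\<^sub>F y in nhds x. (deriv ^^ n) (cardinal_dev \<nu> c m) y
    = (deriv ^^ n) (\<lambda>x. if x = 0 then 0 else cardinal_dev \<nu> c m x) y"
proof -
  have "\<forall>\<^sub>F y in nhds x. y \<in> - {0}"
    using assms by (intro eventually_nhds_in_open) auto
  then have "\<forall>\<^sub>F y in nhds x. cardinal_dev \<nu> c m y = (if y = 0 then 0 else cardinal_dev \<nu> c m y)"
    by eventually_elim simp
  then have "\<forall>\<^sub>F z in nhds x. \<forall>\<^sub>F y in nhds z. cardinal_dev \<nu> c m y = (if y = 0 then 0 else cardinal_dev \<nu> c m y)"
    by (simp only: eventually_eventually)
  then show ?thesis
    by eventually_elim (rule higher_deriv_cong_ev[OF _ refl])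
qed

section \<open>Regularity and decay on the whole line\<close>

lemma ex_reduced_shift:
  obtains m :: int and x :: real where "\<xi> = x + 2 * pi * of_int m" "\<bar>x\<bar> \<le> pi"
proof
  define m where "m = round (\<xi> / (2 * pi))"
  show "\<xi> = (\<xi> - 2 * pi * of_int m) + 2 * pi * of_int m" by simp
  have "\<bar>of_int m - \<xi> / (2 * pi)\<bar> \<le> 1 / 2"
    unfolding m_def by (rule of_int_round_abs_le)
  then have "2 * pi * \<bar>of_int m - \<xi> / (2 * pi)\<bar> \<le> 2 * pi * (1 / 2)"
    by (intro mult_left_mono) auto
  moreover have "2 * pi * \<bar>of_int m - \<xi> / (2 * pi)\<bar> = \<bar>2 * pi * (of_int m - \<xi> / (2 * pi))\<bar>"
    by (simp add: abs_mult)
  moreover have "2 * pi * (of_int m - \<xi> / (2 * pi)) = 2 * pi * of_int m - \<xi>"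
    by (simp add: right_diff_distrib)
  ultimately show "\<bar>\<xi> - 2 * pi * of_int m\<bar> \<le> pi" by simp
qed

lemma higher_deriv_cardinal_hat_differentiable:
  assumes \<alpha>: "\<alpha> > 0" "\<alpha> \<notin> \<nat>" and c: "c \<ge> 1" and x: "\<bar>x\<bar> < 4"
    and "x \<noteq> 0 \<or> (\<exists>k. j < k \<and> real k \<le> 2 * \<alpha> + 1)"
  shows "(deriv ^^ j) (cardinal_hat \<alpha> c) differentiable at (x + 2 * pi * of_int m)"
proof -
  let ?g = "\<lambda>x. if x = 0 then 0 else cardinal_dev (\<alpha> + 1 / 2) c m x"
  have \<nu>: "\<alpha> + 1 / 2 > 1 / 2" using \<alpha> by simp
  have "(deriv ^^ j) ?g differentiable at x"
  proof (cases "x = 0")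
    case False
    show ?thesis
      by (rule differentiable_cong_ev[OF eventually_higher_deriv_cardinal_dev[OF False]
            higher_deriv_cardinal_dev_differentiable[OF \<nu> c False x]])
  next
    case True
    then obtain k where k: "j < k" "real k \<le> 2 * \<alpha> + 1" using assms(5) by auto
    have even: "even k" if "real k = 2 * \<alpha> + 1"
    proof (rule ccontr)
      assume "odd k"
      then obtain i where "k = 2 * i + 1" by (rule oddE)
      then have "\<alpha> = of_nat i" using that by simp
      then show False using \<alpha>(2) by simp
    qed
    obtain l U where U: "euler_lim k l U"
      "\<forall>\<^sub>F x in at 0. cardinal_dev (\<alpha> + 1 / 2) c m x = \<bar>x\<bar> powr (2 * (\<alpha> + 1 / 2)) * U x"
      using cardinal_dev_euler_lim[OF \<nu> c] by blast
    have "\<forall>\<^sub>F x in at 0. ?g x = \<bar>x\<bar> powr (2 * \<alpha> + 1) * U x"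
      using U(2) eventually_neq_at_within[of 0] by eventually_elim (simp add: algebra_simps)
    then show ?thesis
      unfolding True using U(1) k even
      by (intro higher_deriv_differentiable_abs_powr_mult[where k = k and U = U and a = "2 * \<alpha> + 1" and l = l]) auto
  qed
  then have "(\<lambda>x. (deriv ^^ j) ?g x + (if j = 0 then of_bool (m = 0) else 0)) differentiable at x"
    by (intro derivative_intros) auto
  moreover have "\<forall>\<^sub>F y in nhds x. y \<in> {-4<..<4}"
    using x by (intro eventually_nhds_in_open) auto
  then have "\<forall>\<^sub>F y in nhds x. (deriv ^^ j) ?g y + (if j = 0 then of_bool (m = 0) else 0)
      = (deriv ^^ j) (cardinal_hat \<alpha> c) (y + 2 * pi * of_int m)"
    by eventually_elim (rule higher_deriv_cardinal_hat_eq[OF \<alpha> c, symmetric], auto)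
  ultimately have "(\<lambda>y. (deriv ^^ j) (cardinal_hat \<alpha> c) (y + 2 * pi * of_int m)) differentiable at x"
    by (rule differentiable_cong_ev[rotated])
  then show ?thesis
    unfolding real_differentiable_def DERIV_shift .
qed

lemma higher_deriv_cardinal_hat_le:
  assumes \<alpha>: "\<alpha> > 0" "\<alpha> \<notin> \<nat>" and k: "real k \<le> 2 * \<alpha> + 1"
  obtains A where "A \<ge> 0" and "\<And>c \<xi>. c \<ge> 1 \<Longrightarrow> \<nexists>m::int. \<xi> = 2 * pi * of_int m \<Longrightarrow>
    \<bar>(deriv ^^ k) (cardinal_hat \<alpha> c) \<xi>\<bar> \<le> A * c ^ k * (1 + \<bar>\<xi>\<bar>) powr (- (2 * \<alpha> + 1))"
proof -
  define \<nu> where "\<nu> = \<alpha> + 1 / 2"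
  have \<nu>: "\<nu> > 1 / 2" "real k \<le> 2 * \<nu>" "2 * \<alpha> + 1 = 2 * \<nu>" using \<alpha> k by (auto simp: \<nu>_def)
  define Z where "Z = (\<Sum>n. real (Suc n) powr (- 2 * \<nu>))"
  have Z: "Z \<ge> 0" unfolding Z_def by (intro suminf_nonneg summable_Suc_powr \<nu>) auto
  obtain B where B: "B \<ge> 0" "\<And>c m x. c \<ge> 1 \<Longrightarrow> x \<noteq> 0 \<Longrightarrow> \<bar>x\<bar> \<le> pi \<Longrightarrow>
      \<bar>(deriv ^^ k) (cardinal_dev \<nu> c m) x\<bar> \<le> B * c ^ k *
      (if m = 0 then Z else (2 * \<bar>of_int m\<bar>) powr (- 2 * \<nu>))"
    using higher_deriv_cardinal_dev_le[OF \<nu>(1,2)] unfolding Z_def by blast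
  \<comment> \<open>The 7 converts decay in m into decay in \<xi>: 1 + |\<xi>| < 5 + 8 |m| \<le> 14
    |m| for m nonzero, and 1 + |\<xi>| < 7 for m = 0. In Z + 1 the Z covers m = 0 and the 1 the
    other m; the outer 1 pays for the value 1 at the origin.\<close>
  define A where "A = (B * (Z + 1) + 1) * 7 powr (2 * \<nu>)"
  show ?thesis
  proof (rule that[of A])
    show "A \<ge> 0" using B(1) Z by (simp add: A_def)
    fix c \<xi> :: real
    assume c: "c \<ge> 1" and \<xi>: "\<nexists>m::int. \<xi> = 2 * pi * of_int m"
    obtain m x where mx: "\<xi> = x + 2 * pi * of_int m" "\<bar>x\<bar> \<le> pi"
      by (rule ex_reduced_shift)
    have x: "x \<noteq> 0" "\<bar>x\<bar> < 4" using \<xi> mx pi_less_4 by auto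
    define q where "q = (if m = 0 then Z else (2 * \<bar>of_int m\<bar>) powr (- 2 * \<nu>))"
    define w where "w = 7 powr (2 * \<nu>) * (1 + \<bar>\<xi>\<bar>) powr (- 2 * \<nu>)"
    have w_alt: "w = ((1 + \<bar>\<xi>\<bar>) / 7) powr (- 2 * \<nu>)"
      by (simp add: w_def powr_divide powr_minus_divide)
    have q: "q \<le> (Z + 1) * w \<and> (m = 0 \<longrightarrow> 1 \<le> w)"
    proof (cases "m = 0")
      case True
      then have "(1 + \<bar>\<xi>\<bar>) / 7 \<le> 1" using mx x by simp
      then have "1 powr (- 2 * \<nu>) \<le> w"
        unfolding w_alt using \<nu>(1) by (intro powr_mono2') auto
      then have w1: "1 \<le> w" by simp
      have "Z * 1 \<le> Z * w" using Z w1 by (intro mult_left_mono) auto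
      then show ?thesis using True w1 by (simp add: q_def distrib_right)
    next
      case False
      then have m1: "1 \<le> \<bar>real_of_int m\<bar>" by linarith
      have "\<bar>2 * pi * real_of_int m\<bar> \<le> 8 * \<bar>real_of_int m\<bar>"
        using pi_less_4 by (simp add: abs_mult mult_right_mono)
      moreover have "\<bar>\<xi>\<bar> \<le> \<bar>x\<bar> + \<bar>2 * pi * real_of_int m\<bar>"
        unfolding mx(1) by (rule abs_triangle_ineq)
      ultimately have "(1 + \<bar>\<xi>\<bar>) / 7 \<le> 2 * \<bar>real_of_int m\<bar>"
        using x(2) m1 by simp
      then have "q \<le> w"
        unfolding w_alt q_def using \<nu>(1) False by (simp, intro powr_mono2') auto
      moreover have "0 \<le> Z * w" using Z by (simp add: w_def)
      ultimately show ?thesis using False by (simp add: distrib_right)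
    qed
    \<comment> \<open>The constant 1 at m = 0 survives differentiation only for k = 0; keeping it
      for all k, below c^k, avoids a case split.\<close>
    have "\<bar>(deriv ^^ k) (cardinal_hat \<alpha> c) \<xi>\<bar> \<le> \<bar>(deriv ^^ k) (cardinal_dev \<nu> c m) x\<bar> + of_bool (m = 0)"
      unfolding mx(1) higher_deriv_cardinal_hat_eq[OF \<alpha> c x(2)] \<nu>_def[symmetric]
        eventually_nhds_x_imp_x[OF eventually_higher_deriv_cardinal_dev[OF x(1)], symmetric]
      using abs_triangle_ineq[of "cardinal_dev \<nu> c 0 x" 1] by simp
    also have "\<dots> \<le> B * c ^ k * q + c ^ k * of_bool (m = 0)"
      unfolding q_def using c x mx by (intro add_mono B) auto
    also have "\<dots> \<le> B * c ^ k * ((Z + 1) * w) + c ^ k * w"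
    proof (intro add_mono mult_left_mono)
      show "of_bool (m = 0) \<le> w" using q by (simp add: w_def)
    qed (use q c B in auto)
    also have "\<dots> = (B * (Z + 1) + 1) * c ^ k * w"
      by (simp add: algebra_simps)
    also have "\<dots> = A * c ^ k * (1 + \<bar>\<xi>\<bar>) powr (- (2 * \<alpha> + 1))"
      unfolding A_def w_def \<nu>(3) by simp
    finally show "\<bar>(deriv ^^ k) (cardinal_hat \<alpha> c) \<xi>\<bar> \<le> A * c ^ k * (1 + \<bar>\<xi>\<bar>) powr (- (2 * \<alpha> + 1))" .
  qed
qed

lemma integrable_one_plus_abs_powr:
  fixes a :: real
  assumes "a > 1"
  shows "integrable lborel (\<lambda>x. (1 + \<bar>x\<bar>) powr (- a))"
proof -
  define h where "h x = (1 + \<bar>x\<bar>) powr (- a) * indicator {0..} x" for x :: real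
  have "(\<integral>\<^sup>+x. ennreal ((1 + \<bar>x\<bar>) powr (- a)) * indicator {0..} x \<partial>lborel)
      = ennreal (0 - (- (1 / (a - 1)) * (1 + 0) powr (1 - a)))"
  proof (rule nn_integral_FTC_atLeast)
    show "((\<lambda>x. - (1 / (a - 1)) * (1 + x) powr (1 - a)) has_real_derivative (1 + \<bar>x\<bar>) powr (- a)) (at x)"
      if "0 \<le> x" for x
    proof -
      have "((\<lambda>x. - (1 / (a - 1)) * (1 + x) powr (1 - a)) has_real_derivative
          - (1 / (a - 1)) * ((1 - a) * (1 + x) powr (- a))) (at x)"
        using that by (intro DERIV_cmult) (auto intro!: derivative_eq_intros)
      moreover have "- (1 / (a - 1)) * (1 - a) = 1" using assms by (simp add: field_simps)
      ultimately show ?thesis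
        using that by (simp only: mult.assoc[symmetric]) simp
    qed
    show "((\<lambda>x. - (1 / (a - 1)) * (1 + x) powr (1 - a)) \<longlongrightarrow> 0) at_top"
      using assms
      by (intro tendsto_mult_right_zero tendsto_neg_powr filterlim_tendsto_add_at_top[OF tendsto_const]
          filterlim_ident) auto
  qed auto
  then have h: "integrable lborel h"
    unfolding h_def by (intro integrableI_nonneg) (auto simp: ennreal_mult' ennreal_indicator)
  \<comment> \<open>Half line plus reflection counts the point 0 twice, so the sum is used as a
    majorant only.\<close>
  have "integrable lborel (\<lambda>x. h x + h (0 + (- 1) * x))"
    by (intro Bochner_Integration.integrable_add h lborel_integrable_real_affine) auto
  then show ?thesis
    by (rule Bochner_Integration.integrable_bound)
       (auto intro!: AE_I2 simp: h_def split: split_indicator)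
qed

text \<open>Differentiability of all orders below k at every real point certifies that
  \<open>(deriv ^^ k)\<close> is the genuine k-th derivative everywhere, including the lattice
  points.\<close>

theorem theorem10:
  fixes \<alpha> :: real and k :: nat
  assumes "\<alpha> > 0" and "\<alpha> \<notin> \<nat>" and "real k \<le> 2 * \<alpha> + 1"
  shows "\<exists>A>0. \<forall>c\<ge>1.
           (\<forall>j<k. (deriv ^^ j) (cardinal_hat \<alpha> c) differentiable_on UNIV) \<and>
           integrable lborel ((deriv ^^ k) (cardinal_hat \<alpha> c)) \<and>
           (LBINT \<xi>. \<bar>(deriv ^^ k) (cardinal_hat \<alpha> c) \<xi>\<bar>)
             \<le> A * c powr ((2 * real k + 1) * (2 * \<alpha> - of_int \<lfloor>\<alpha>\<rfloor>) + real k)"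
proof -
  obtain A where A: "A \<ge> 0" "\<And>c \<xi>. c \<ge> 1 \<Longrightarrow> \<nexists>m::int. \<xi> = 2 * pi * of_int m \<Longrightarrow>
    \<bar>(deriv ^^ k) (cardinal_hat \<alpha> c) \<xi>\<bar> \<le> A * c ^ k * (1 + \<bar>\<xi>\<bar>) powr (- (2 * \<alpha> + 1))"
    using higher_deriv_cardinal_hat_le[OF assms] by blast
  define g where "g \<xi> = (1 + \<bar>\<xi>\<bar>) powr (- (2 * \<alpha> + 1))" for \<xi> :: real
  define I where "I = (LBINT \<xi>. g \<xi>)"
  have g: "integrable lborel g"
    unfolding g_def using assms(1) by (intro integrable_one_plus_abs_powr) simp
  have I: "I \<ge> 0" unfolding I_def g_def by simp
  let ?L = "range (\<lambda>m::int. 2 * pi * of_int m)"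
  have L: "countable ?L" by simp
  show ?thesis
  proof (intro exI[of _ "A * I + 1"] conjI allI impI)
    show "0 < A * I + 1" using A(1) I by (simp add: add_nonneg_pos)
  next
    fix c :: real and j assume c: "c \<ge> 1" and j: "j < k"
    have "(deriv ^^ j) (cardinal_hat \<alpha> c) differentiable at \<xi>" for \<xi>
    proof -
      obtain m x where mx: "\<xi> = x + 2 * pi * of_int m" "\<bar>x\<bar> \<le> pi" by (rule ex_reduced_shift)
      then show ?thesis
        unfolding mx(1) using assms c j pi_less_4
        by (intro higher_deriv_cardinal_hat_differentiable) auto
    qed
    then show "(deriv ^^ j) (cardinal_hat \<alpha> c) differentiable_on UNIV"
      by (simp add: differentiable_on_def)
  next
    fix c :: real assume c: "c \<ge> 1"
    let ?f = "(deriv ^^ k) (cardinal_hat \<alpha> c)"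
    have "?f differentiable at \<xi>" if "\<xi> \<in> - ?L" for \<xi>
    proof -
      obtain m x where mx: "\<xi> = x + 2 * pi * of_int m" "\<bar>x\<bar> \<le> pi" by (rule ex_reduced_shift)
      then have "x \<noteq> 0" using that by auto
      then show ?thesis
        unfolding mx(1) using assms c pi_less_4 mx
        by (intro higher_deriv_cardinal_hat_differentiable) auto
    qed
    \<comment> \<open>Continuity of the k-th derivative is claimed off the lattice only; a countable
      exceptional set does not affect measurability.\<close>
    then have "continuous_on (- ?L) ?f"
      by (intro continuous_at_imp_continuous_on ballI differentiable_imp_continuous_within)
    then have meas: "?f \<in> borel_measurable borel"
      by (rule borel_measurable_continuous_countable_exceptions[OF L])
    have "AE \<xi> in lborel. \<xi> \<notin> ?L"
      using countable_imp_null_set_lborel[OF L] by (rule AE_not_in)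
    then have bound: "AE \<xi> in lborel. \<bar>?f \<xi>\<bar> \<le> A * c ^ k * g \<xi>"
    proof eventually_elim
      case (elim \<xi>)
      then have "\<nexists>m::int. \<xi> = 2 * pi * of_int m" by auto
      from A(2)[OF c this] show ?case unfolding g_def .
    qed
    have gc: "integrable lborel (\<lambda>\<xi>. A * c ^ k * g \<xi>)"
      using g by simp
    show int: "integrable lborel ?f"
      using bound meas by (intro Bochner_Integration.integrable_bound[OF gc]) (auto elim!: eventually_mono)
    have "(LBINT \<xi>. \<bar>?f \<xi>\<bar>) \<le> (LBINT \<xi>. A * c ^ k * g \<xi>)"
      using bound by (intro integral_mono_AE integrable_abs int gc)
    also have "\<dots> = A * I * c ^ k"
      by (simp add: I_def)
    \<comment> \<open>The summand 1 keeps the constant positive even if \<open>A * I\<close> is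
      0.\<close>
    also have "\<dots> \<le> (A * I + 1) * c ^ k"
      using c by (intro mult_right_mono) auto
    also have "c ^ k = c powr real k"
      using c by (simp add: powr_realpow)
    also have "(A * I + 1) * c powr real k
        \<le> (A * I + 1) * c powr ((2 * real k + 1) * (2 * \<alpha> - of_int \<lfloor>\<alpha>\<rfloor>) + real k)"
    proof (intro mult_left_mono powr_mono)
      have "of_int \<lfloor>\<alpha>\<rfloor> \<le> \<alpha>" by (rule of_int_floor_le)
      then have "0 \<le> 2 * \<alpha> - of_int \<lfloor>\<alpha>\<rfloor>" using assms(1) by linarith
      then have "0 \<le> (2 * real k + 1) * (2 * \<alpha> - of_int \<lfloor>\<alpha>\<rfloor>)"
        by (intro mult_nonneg_nonneg) auto
      then show "real k \<le> (2 * real k + 1) * (2 * \<alpha> - of_int \<lfloor>\<alpha>\<rfloor>) + real k" by simp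
    qed (use c A(1) I in auto)
    finally show "(LBINT \<xi>. \<bar>?f \<xi>\<bar>)
        \<le> (A * I + 1) * c powr ((2 * real k + 1) * (2 * \<alpha> - of_int \<lfloor>\<alpha>\<rfloor>) + real k)" .
  qed
qed

end
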